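(* Let $k\in L^1_{loc}(\mathbb{R}_+)$ be a nonnegative function whose Laplace transform $\widehat k(s)$ exists for all $s>0$, is a Stieltjes function, and satisfies $$\widehat{k}(s)\to 0,\ s\widehat{k}(s)\to \infty \ \text{ as } s\to \infty;\qquad \widehat{k}(s)\to \infty,\ s\widehat{k}(s)\to 0 \ \text{ as } s\to 0^+ .$$ Let $u(t;\lambda)$ and $v(t;\lambda)$ be the fundamental solution and the impulse-response solution of the relaxation equation $(\mathbb{D}_{(k)}u)(t)+\lambda u(t)=f(t)$, $t>0$, $u(0)=a$. Then for any $\lambda>0$ the functions $u(t;\lambda)$ and $v(t;\lambda)$ admit holomorphic extensions (in $t$) to the half-plane $\Re t>0$, and: (1) $u(t;\lambda)$ and $v(t;\lambda)$ are completely monotone in $t>0$; (2) $u(0;\lambda)=1$, and $0<u(t;\lambda)<1$, $v(t;\lambda)>0$ for all $t>0$; (3) $\frac{\partial}{\partial t}u(t;\lambda)=-\lambda v(t;\lambda)$ for $t>0$. Moreover, for any $\lambda\ge\lambda_1>0$ and $t>0$, $$u(t;\lambda)\le u(t;\lambda_1),\qquad v(t;\lambda)\le v(t;\lambda_1),$$ and for any $\lambda\ge\lambda_1>0$ and $T>0$, $$C\le \lambda\int_0^T v(t;\lambda)\,dt<1,$$ where the constant $C=1-u(T;\lambda_1)>0$ is independent of $\lambda$.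
   Context: Here $\mathbb{R}_+=[0,\infty)$ and $\widehat{f}(s)=\int_0^\infty e^{-st}f(t)\,dt$ denotes the Laplace transform. The general convolutional derivative is $(\mathbb{D}_{(k)} f)(t)=\frac{d}{dt}\int_0^t k(t-\tau)f(\tau)\,d\tau-k(t)f(0)$, $t>0$. A function $f$ on $(0,\infty)$ is completely monotone if it is infinitely differentiable and $(-1)^n f^{(n)}(t)\ge 0$ for all $n=0,1,\dots$ and $t>0$. A function $\varphi$ on $(0,\infty)$ is a Stieltjes function if $\varphi(s)=\frac{a}{s}+b+\int_0^\infty e^{-s\tau}\psi_0(\tau)\,d\tau$ for some $a,b\ge 0$ and some completely monotone $\psi_0$ whose Laplace transform exists for all $s>0$. The solution of the relaxation equation $(\mathbb{D}_{(k)}u)(t)+\lambda u(t)=f(t)$, $t>0$, $u(0)=a$ ($a\in\mathbb{R}$) is represented as $u(t)=a\,u(t;\lambda)+\int_0^t v(t-\tau;\lambda)f(\tau)\,d\tau$; $u(t;\lambda)$ is called the fundamental solution and $v(t;\lambda)$ the impulse-response solution. With $g(s):=s\widehat k(s)$, they are the functions, continuous for $t\ge0$ and $t>0$ respectively, determined by their Laplace transforms in $t$: $$\widehat{u}(s;\lambda)=\frac{g(s)}{s(g(s)+\lambda)},\qquad \widehat{v}(s;\lambda)=\frac{1}{g(s)+\lambda},\qquad s>0.$$ *)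

theory Defs
  imports "HOL-Complex_Analysis.Complex_Analysis"
begin

text \<open>
  Functions of \<open>t > 0\<close> are total functions on the reals whose values at \<open>t \<le> 0\<close> are irrelevant
  (except for those at \<open>0\<close> of functions required to be continuous on \<open>{0..}\<close>), hence
  the domain \<open>{0<..}\<close> of the Laplace integral. Its existence is absolute (Lebesgue) convergence.
\<close>

definition laplace_exists :: "(real \<Rightarrow> real) \<Rightarrow> real \<Rightarrow> bool" where
  "laplace_exists f s \<longleftrightarrow> (\<lambda>t. exp (- s * t) * f t) absolutely_integrable_on {0<..}"

definition laplace :: "(real \<Rightarrow> real) \<Rightarrow> real \<Rightarrow> real" where
  "laplace f s = (LINT t:{0<..}|lebesgue. exp (- s * t) * f t)"

definition locally_integrable :: "(real \<Rightarrow> real) \<Rightarrow> bool" where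
  "locally_integrable f \<longleftrightarrow> (\<forall>T>0. f absolutely_integrable_on {0..T})"

definition completely_monotone :: "(real \<Rightarrow> real) \<Rightarrow> bool" where
  "completely_monotone f \<longleftrightarrow>
     (\<forall>n. \<forall>t>0. (deriv ^^ n) f differentiable (at t) \<and> 0 \<le> (- 1) ^ n * (deriv ^^ n) f t)"

definition stieltjes_function :: "(real \<Rightarrow> real) \<Rightarrow> bool" where
  "stieltjes_function \<phi> \<longleftrightarrow>
     (\<exists>a b \<psi>. 0 \<le> a \<and> 0 \<le> b \<and> completely_monotone \<psi> \<and> (\<forall>s>0. laplace_exists \<psi> s) \<and>
        (\<forall>s>0. \<phi> s = a / s + b + laplace \<psi> s))"

definition symbol_of :: "(real \<Rightarrow> real) \<Rightarrow> real \<Rightarrow> real" where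
  "symbol_of k s = s * laplace k s"

text \<open>
  \<open>fundamental_solution k lam u\<close> and \<open>impulse_response k lam v\<close> say that \<open>u\<close> and \<open>v\<close> are the
  fundamental and the impulse-response solution of the relaxation equation
  \<open>D\<^sub>k u + lam u = f\<close>, \<open>u(0) = a\<close>, where \<open>D\<^sub>k\<close> is the general convolutional derivative
  \<open>(D\<^sub>k f)(t) = d/dt (\<integral>\<^bsub>0\<^esub>\<^bsup>t\<^esup> k(t - \<tau>) f(\<tau>) d\<tau>) - k(t) f(0)\<close>
  with symbol \<open>g(s) = s k^(s)\<close>; they are specified by continuity and by their Laplace transforms.
\<close>

definition fundamental_solution :: "(real \<Rightarrow> real) \<Rightarrow> real \<Rightarrow> (real \<Rightarrow> real) \<Rightarrow> bool" where
  "fundamental_solution k lam u \<longleftrightarrow>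
     continuous_on {0..} u \<and>
     (\<forall>s>0. laplace_exists u s \<and>
        laplace u s = symbol_of k s / (s * (symbol_of k s + lam)))"

definition impulse_response :: "(real \<Rightarrow> real) \<Rightarrow> real \<Rightarrow> (real \<Rightarrow> real) \<Rightarrow> bool" where
  "impulse_response k lam v \<longleftrightarrow>
     continuous_on {0<..} v \<and>
     (\<forall>s>0. laplace_exists v s \<and> laplace v s = 1 / (symbol_of k s + lam))"

definition has_holomorphic_extension :: "(real \<Rightarrow> real) \<Rightarrow> bool" where
  "has_holomorphic_extension f \<longleftrightarrow>
     (\<exists>F. F holomorphic_on {z. 0 < Re z} \<and>
        (\<forall>t>0. F (complex_of_real t) = complex_of_real (f t)))"

end

theory Submission
  imports Defs "HOL-Probability.Distributions" "HOL-Real_Asymp.Real_Asymp"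
begin

unbundle no vec_syntax

text \<open>
  Why the theorem holds. The behaviour of \<open>k^(s)\<close> at infinity and of \<open>s k^(s)\<close> at \<open>0\<close> removes the two
  constants of the Stieltjes representation, so \<open>k^\<close> is the Laplace transform of a completely
  monotone function \<open>\<psi>\<close>. The heart of the matter is that
  \<open>k^ / (s k^ + lam)\<close> is then the transform of a completely monotone function too. In complex
  analysis this is the stability of Stieltjes functions under inversion, read off from integral
  representations; here it is obtained from a discrete model in which the inversion is
  algebra and no representing measure has to be constructed.

  The model. Sampling \<open>\<psi>\<close> at mesh \<open>1 / n\<close> gives a completely monotone sequence; let \<open>A(X)\<close> be its
  generating series. With \<open>s\<close> replaced by \<open>n (1 - X)\<close>, the transforms of the impulse response and of
  the fundamental solution become \<open>V = 1 / (n (1 - X) A + lam)\<close> and \<open>U = A V\<close>. The coefficients of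
  \<open>U\<close> are again completely monotone (\<open>cm_seq_resolvent\<close>). Indeed, by Hausdorff, complete
  monotonicity of \<open>b\<close> means that the functional \<open>L\<close> with \<open>L(x^i) = b i\<close> is nonnegative on all
  \<open>x p^2\<close> and \<open>(1 - x) p^2\<close>. The Hankel identities \<open>hankel_Suc\<close> and \<open>hankel_nabla\<close> express
  these two quadratic forms for \<open>U\<close> as congruence transforms, by the Toeplitz matrix of \<open>V\<close>, of the
  forms for \<open>A\<close>, plus a square. They are the coefficient form of the Nevanlinna kernel identity
  \<open>1/F(y) - 1/F(x) = (F(x) - F(y)) / (F(x) F(y))\<close>.

  Back to functions. The Poisson means of the sequence \<open>n U\<close> form an entire function which is completely
  monotone on the half-line. Its Taylor series around a distant real point bounds it by \<open>1\<close>
  on the whole half-plane \<open>Re z > 0\<close> (\<open>norm_szasz_le\<close>). Its transform is explicit and tends to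
  \<open>k^ / (s k^ + lam)\<close> as \<open>n\<close> grows (\<open>laplace_approx\<close>). Montel's theorem yields a subsequence that
  converges with all derivatives, so the limit \<open>u\<close> is holomorphic, completely monotone and has the
  right transform (\<open>relaxation_construction\<close>).

  The rest. The impulse response is \<open>v = - u' / lam\<close>; the Laplace transform of \<open>v\<close> and the value
  \<open>lam * \<integral> v = 1 - u(T)\<close> come from the fundamental theorem of calculus, \<open>u(0+) = 1\<close> from
  \<open>s k^(s) \<rightarrow> \<infinity>\<close>, and the strict inequalities from the identity theorem. Uniqueness of Laplace
  transforms (\<open>laplace_unique\<close>) identifies these functions with any given solutions. Finally, the
  coefficients of \<open>U\<close> and \<open>V\<close> decrease in \<open>lam\<close> by the resolvent identity, and this survives the
  limit along a common subsequence.
\<close>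

section \<open>Completely monotone sequences and quadratic forms\<close>

definition nabla :: "(nat \<Rightarrow> real) \<Rightarrow> nat \<Rightarrow> real" where
  "nabla a m = a m - a (Suc m)"

definition cm_seq :: "(nat \<Rightarrow> real) \<Rightarrow> bool" where
  "cm_seq a \<longleftrightarrow> (\<forall>j m. 0 \<le> (nabla ^^ j) a m)"

text \<open>
  The linear functional on polynomials that sends \<open>x^i\<close> to \<open>a i\<close>; for a moment sequence it is
  integration against the representing measure.
\<close>

definition moment :: "(nat \<Rightarrow> real) \<Rightarrow> real poly \<Rightarrow> real" where
  "moment a p = (\<Sum>i\<le>degree p. coeff p i * a i)"

lemma moment_lessThan:
  assumes "degree p < N"
  shows "moment a p = (\<Sum>i<N. coeff p i * a i)"
  unfolding moment_def
  by (rule sum.mono_neutral_left) (use assms in \<open>auto simp: coeff_eq_0\<close>)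

lemma moment_add: "moment a (p + q) = moment a p + moment a q"
proof -
  define N where "N = Suc (max (degree p) (degree q))"
  have "degree (p + q) < N" "degree p < N" "degree q < N"
    using degree_add_le_max[of p q] unfolding N_def by auto
  then show ?thesis by (simp add: moment_lessThan sum.distrib algebra_simps)
qed

lemma moment_smult: "moment a (smult c p) = c * moment a p"
proof -
  have "degree (smult c p) < Suc (degree p)" by (simp add: le_imp_less_Suc degree_smult_le)
  then show ?thesis
    by (simp only: moment_lessThan[of _ "Suc (degree p)"] lessI)
       (simp add: sum_distrib_left algebra_simps)
qed

lemma moment_shift: "moment (\<lambda>i. a (Suc i)) p = moment a ([:0, 1:] * p)"
proof -
  have "moment a ([:0, 1:] * p) = (\<Sum>i<Suc (Suc (degree p)). coeff (pCons 0 p) i * a i)"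
    by (simp add: moment_lessThan[of _ "Suc (Suc (degree p))"])
  also have "\<dots> = (\<Sum>i<Suc (degree p). coeff p i * a (Suc i))"
    by (subst sum.lessThan_Suc_shift) simp
  finally show ?thesis by (simp add: moment_lessThan[of _ "Suc (degree p)"])
qed

lemma moment_nabla: "moment (nabla a) p = moment a ([:1, -1:] * p)"
proof -
  have "moment (nabla a) p = moment a p - moment (\<lambda>i. a (Suc i)) p"
    by (simp add: moment_def nabla_def sum_subtractf algebra_simps)
  also have "\<dots> = moment a (p + smult (- 1) ([:0, 1:] * p))"
    by (simp only: moment_add moment_smult moment_shift)
  also have "p + smult (- 1) ([:0, 1:] * p) = [:1, -1:] * p" by simp
  finally show ?thesis .
qed

text \<open>
  Shifting a sequence multiplies the argument of its functional by \<open>x\<close>, differencing multiplies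
  it by \<open>1 - x\<close>.
\<close>

lemma nabla_funpow_moment: "(nabla ^^ j) a m = moment a ([:0, 1:] ^ m * [:1, -1:] ^ j)"
proof -
  have *: "moment a ([:0, 1:] ^ m * p) = moment (\<lambda>i. a (i + m)) p" for a p
  proof (induction m arbitrary: a)
    case (Suc m)
    have "moment a ([:0, 1:] ^ Suc m * p) = moment (\<lambda>i. a (Suc i)) ([:0, 1:] ^ m * p)"
      by (simp only: moment_shift power_Suc mult.assoc)
    then show ?case by (simp add: Suc.IH)
  qed simp
  have shift: "(nabla ^^ j) (\<lambda>i. a (i + m)) = (\<lambda>i. (nabla ^^ j) a (i + m))" for a j
    by (induction j) (auto simp: nabla_def fun_eq_iff)
  have "moment a ([:1, -1:] ^ j) = (nabla ^^ j) a 0" for a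
  proof (induction j arbitrary: a)
    case (Suc j)
    have "moment a ([:1, -1:] ^ Suc j) = moment (nabla a) ([:1, -1:] ^ j)"
      by (simp only: moment_nabla power_Suc)
    then show ?case by (simp add: Suc.IH funpow_swap1)
  qed (simp add: moment_def)
  then show ?thesis by (simp only: * shift) simp
qed

lemma moment_mult:
  assumes "degree p < N" "degree q < N"
  shows "moment a (p * q) = (\<Sum>i<N. \<Sum>j<N. coeff p i * coeff q j * a (i + j))"
proof -
  have "moment a (p * q) = (\<Sum>i<N. coeff p i * moment (\<lambda>j. a (i + j)) q)" 
    using assms(1)
  proof (induction N arbitrary: p a)
    case (Suc N)
    obtain c p' where p: "p = pCons c p'" by (cases p)
    show ?case
    proof (cases "p' = 0")
      case True
      then show ?thesis
        by (simp add: p moment_smult sum.lessThan_Suc_shift del: sum.lessThan_Suc)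
    next
      case False
      then have d: "degree p' < N" using Suc.prems p by simp
      have "moment a (p * q) = c * moment a q + moment (\<lambda>i. a (Suc i)) (p' * q)"
        by (simp add: p moment_add moment_smult moment_shift)
      also have "moment (\<lambda>i. a (Suc i)) (p' * q) = (\<Sum>i<N. coeff p' i * moment (\<lambda>j. a (Suc (i + j))) q)"
        using Suc.IH[OF d] by simp
      finally show ?thesis by (simp add: sum.lessThan_Suc_shift p del: sum.lessThan_Suc)
    qed
  qed simp
  then show ?thesis
    using assms(2) by (simp add: moment_lessThan sum_distrib_left mult_ac)
qed

text \<open>
  The identity and the shift satisfy \<open>1 = nabla + shift\<close>; this is the binomial expansion of
  \<open>1 ^ M\<close>.
\<close>

lemma nabla_expansion:
  "a m = (\<Sum>i\<le>M. real (M choose i) * (nabla ^^ (M - i)) a (m + i))"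
proof (induction M arbitrary: a m)
  case (Suc M)
  define X where "X i = (nabla ^^ (Suc M - i)) a (m + i)" for i
  have sw: "(nabla ^^ (M - i)) (nabla a) = (nabla ^^ (Suc M - i)) a" if "i \<le> M" for i
    using that by (simp add: Suc_diff_le funpow_swap1)
  have "a m = nabla a m + a (Suc m)" by (simp add: nabla_def)
  also have "nabla a m = (\<Sum>i\<le>M. real (M choose i) * X i)"
    by (subst Suc.IH) (auto simp: X_def sw intro!: sum.cong)
  also have "a (Suc m) = (\<Sum>i\<le>M. real (M choose i) * X (Suc i))"
    by (subst Suc.IH) (auto simp: X_def intro!: sum.cong)
  also have "(\<Sum>i\<le>M. real (M choose i) * X i) = (\<Sum>i\<le>Suc M. real (M choose i) * X i)"
    by simp
  also have "\<dots> = X 0 + (\<Sum>i\<le>M. real (M choose Suc i) * X (Suc i))"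
    by (subst sum.atMost_Suc_shift) simp
  also have "\<dots> + (\<Sum>i\<le>M. real (M choose i) * X (Suc i))
      = X 0 + (\<Sum>i\<le>M. real (Suc M choose Suc i) * X (Suc i))"
    by (simp add: sum.distrib algebra_simps)
  also have "\<dots> = (\<Sum>i\<le>Suc M. real (Suc M choose i) * X i)"
    by (subst sum.atMost_Suc_shift) simp
  finally show ?case by (simp add: X_def)
qed simp

text \<open>
  Turns the weights of \<open>nabla_expansion\<close> into Bernstein weights of full order \<open>N\<close>, at the price
  of a quotient of falling factorials that is close to \<open>(j / N)^m\<close>.
\<close>

lemma choose_falling_quotient:
  assumes "m \<le> j" "j \<le> N"
  shows "real ((N - m) choose (j - m)) = real (N choose j) * (\<Prod>i<m. (real j - real i) / (real N - real i))"
  using assms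
proof (induction m)
  case (Suc m)
  have "Suc (j - Suc m) * ((N - m) choose Suc (j - Suc m)) = (N - m) * ((N - Suc m) choose (j - Suc m))"
    using Suc_times_binomial[of "j - Suc m" "N - Suc m"] Suc.prems by (simp add: Suc_diff_Suc)
  then have "(j - m) * ((N - m) choose (j - m)) = (N - m) * ((N - Suc m) choose (j - Suc m))"
    using Suc.prems by (simp add: Suc_diff_Suc)
  then have "real (j - m) * real ((N - m) choose (j - m)) = real (N - m) * real ((N - Suc m) choose (j - Suc m))"
    by (metis of_nat_mult)
  moreover have "real (j - m) = real j - real m" "real (N - m) = real N - real m" "real N - real m > 0"
    using Suc.prems by auto
  ultimately have "real ((N - Suc m) choose (j - Suc m)) = real ((N - m) choose (j - m)) * ((real j - real m) / (real N - real m))"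
    by (simp add: field_simps)
  then show ?case using Suc by simp
qed simp

text \<open>
  Hausdorff's approximation of moments: the nonnegative masses
  \<open>(N choose j) * (nabla ^^ (N - j)) a j\<close> at the points \<open>j / N\<close> have total mass \<open>a 0\<close>, and their
  \<open>m\<close>-th moment differs from \<open>a m\<close> only in that \<open>(j / N)^m\<close> stands for the quotient of falling
  factorials that would be exact.
\<close>

lemma hausdorff_limit:
  assumes "cm_seq a"
  shows "(\<lambda>N. \<Sum>j\<le>N. real (N choose j) * (nabla ^^ (N - j)) a j * (real j / real N) ^ m) \<longlonglongrightarrow> a m"
proof -
  define w where "w N j = real (N choose j) * (nabla ^^ (N - j)) a j" for N j
  define P where "P N j = (\<Prod>i<m. (real j - real i) / (real N - real i))" for N j
  have w0: "0 \<le> w N j" for N j using assms by (simp add: w_def cm_seq_def)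
  have wsum: "(\<Sum>j\<le>N. w N j) = a 0" for N
    using nabla_expansion[of a 0 N] by (simp add: w_def)
  have am: "a m = (\<Sum>j\<le>N. w N j * P N j)" if "m \<le> N" for N
  proof -
    have "a m = (\<Sum>i\<in>{0..N - m}. real ((N - m) choose i) * (nabla ^^ (N - m - i)) a (m + i))"
      by (subst nabla_expansion[of a m "N - m"]) (simp add: atLeast0AtMost)
    also have "\<dots> = (\<Sum>j\<in>{m..N}. real ((N - m) choose (j - m)) * (nabla ^^ (N - j)) a j)"
      by (rule sum.reindex_bij_witness[of _ "\<lambda>j. j - m" "\<lambda>i. i + m"])
         (use that in \<open>auto simp: add.commute\<close>)
    also have "\<dots> = (\<Sum>j\<in>{m..N}. w N j * P N j)"
      by (rule sum.cong) (auto simp: choose_falling_quotient w_def P_def)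
    also have "\<dots> = (\<Sum>j\<le>N. w N j * P N j)"
    proof (rule sum.mono_neutral_left)
      show "\<forall>j\<in>{..N} - {m..N}. w N j * P N j = 0"
      proof
        fix j assume "j \<in> {..N} - {m..N}"
        then have "j < m" by auto
        then have "P N j = 0" unfolding P_def by (intro prod_zero) auto
        then show "w N j * P N j = 0" by simp
      qed
    qed auto
    finally show ?thesis .
  qed
  have bd: "\<bar>P N j - (real j / real N) ^ m\<bar> \<le> real m * (real m / (real N - real m))"
    if "2 * m < N" "j \<le> N" for N j
  proof -
    have one: "\<bar>(real j - real i) / (real N - real i)\<bar> \<le> 1" if "i < m" for i
      using that \<open>2 * m < N\<close> \<open>j \<le> N\<close> by (auto simp: abs_le_iff field_simps)
    have "\<bar>P N j - (\<Prod>i<m. real j / real N)\<bar> \<le> (\<Sum>i<m. \<bar>(real j - real i) / (real N - real i) - real j / real N\<bar>)"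
      unfolding P_def
      using norm_prod_diff[of "{..<m}" "\<lambda>i. (real j - real i) / (real N - real i)" "\<lambda>i. real j / real N"]
      using one that by auto
    also have "\<dots> \<le> (\<Sum>i<m. real m / (real N - real m))"
    proof (rule sum_mono)
      fix i assume "i \<in> {..<m}"
      then have i: "real i < real m" by simp
      have N: "real N > 2 * real m" "real j \<le> real N" using that by linarith+
      have "(real j - real i) / (real N - real i) - real j / real N
          = - (real i / (real N - real i)) * ((real N - real j) / real N)"
        using N i by (simp add: field_simps)
      then have "\<bar>(real j - real i) / (real N - real i) - real j / real N\<bar>
          = real i / (real N - real i) * ((real N - real j) / real N)"
        using N i by (simp add: abs_mult)
      also have "\<dots> \<le> real i / (real N - real i) * 1"
        using N i by (intro mult_left_mono) (auto simp: field_simps)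
      also have "\<dots> \<le> real m / (real N - real m)"
        using N i by (simp add: frac_le)
      finally show "\<bar>(real j - real i) / (real N - real i) - real j / real N\<bar> \<le> real m / (real N - real m)" .
    qed
    finally show ?thesis by simp
  qed
  have "(\<lambda>N. (\<Sum>j\<le>N. w N j * (real j / real N) ^ m) - a m) \<longlonglongrightarrow> 0"
  proof (rule Lim_null_comparison)
    show "\<forall>\<^sub>F N in sequentially. norm ((\<Sum>j\<le>N. w N j * (real j / real N) ^ m) - a m)
        \<le> a 0 * (real m * (real m / (real N - real m)))"
    proof (rule eventually_sequentiallyI)
      fix N assume N: "2 * m + 1 \<le> N"
      have "(\<Sum>j\<le>N. w N j * (real j / real N) ^ m) - a m = (\<Sum>j\<le>N. w N j * ((real j / real N) ^ m - P N j))"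
        using N by (simp add: am[of N] sum_subtractf algebra_simps)
      also have "\<bar>\<dots>\<bar> \<le> (\<Sum>j\<le>N. w N j * (real m * (real m / (real N - real m))))"
      proof (rule order_trans[OF sum_abs sum_mono])
        fix j assume "j \<in> {..N}"
        then show "\<bar>w N j * ((real j / real N) ^ m - P N j)\<bar> \<le> w N j * (real m * (real m / (real N - real m)))"
          using mult_left_mono[OF bd[of N j] w0[of N j]] N w0[of N j]
            by (simp add: abs_mult abs_minus_commute)
      qed
      also have "\<dots> = a 0 * (real m * (real m / (real N - real m)))"
        by (simp only: sum_distrib_right[symmetric] wsum)
      finally show "norm ((\<Sum>j\<le>N. w N j * (real j / real N) ^ m) - a m)
        \<le> a 0 * (real m * (real m / (real N - real m)))" by simp
    qed
    have "filterlim (\<lambda>N. real N - real m) at_top sequentially"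
      using filterlim_tendsto_add_at_top[OF tendsto_const[of "- real m"] filterlim_real_sequentially]
      by simp
    then have "(\<lambda>N. real m / (real N - real m)) \<longlonglongrightarrow> 0"
      by (intro tendsto_divide_0[OF tendsto_const] filterlim_at_top_imp_at_infinity)
    then have "(\<lambda>N. a 0 * (real m * (real m / (real N - real m)))) \<longlonglongrightarrow> a 0 * (real m * 0)"
      by (intro tendsto_intros)
    then show "(\<lambda>N. a 0 * (real m * (real m / (real N - real m)))) \<longlonglongrightarrow> 0" by simp
  qed
  then show ?thesis unfolding w_def by (simp add: LIM_zero_iff)
qed

text \<open>
  The functional is a limit of integrals against the discrete measures of \<open>hausdorff_limit\<close>, all
  carried by the unit interval.
\<close>

lemma cm_seq_moment_nonneg:
  assumes "cm_seq a" and "\<And>x. x \<in> {0..1} \<Longrightarrow> 0 \<le> poly p x"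
  shows "0 \<le> moment a p"
proof (rule LIMSEQ_le_const)
  show "(\<lambda>N. \<Sum>i\<le>degree p. coeff p i * (\<Sum>j\<le>N. real (N choose j) * (nabla ^^ (N - j)) a j * (real j / real N) ^ i))
      \<longlonglongrightarrow> moment a p"
    unfolding moment_def by (intro tendsto_intros hausdorff_limit assms)
  show "\<exists>N0. \<forall>N\<ge>N0. 0 \<le> (\<Sum>i\<le>degree p. coeff p i * (\<Sum>j\<le>N. real (N choose j) * (nabla ^^ (N - j)) a j * (real j / real N) ^ i))"
  proof (intro exI[of _ 0] allI impI)
    fix N :: nat
    have "(\<Sum>i\<le>degree p. coeff p i * (\<Sum>j\<le>N. real (N choose j) * (nabla ^^ (N - j)) a j * (real j / real N) ^ i))
      = (\<Sum>j\<le>N. real (N choose j) * (nabla ^^ (N - j)) a j * poly p (real j / real N))"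
      unfolding poly_altdef sum_distrib_left by (subst sum.swap) (simp add: mult_ac)
    also have "0 \<le> \<dots>"
      using assms by (intro sum_nonneg mult_nonneg_nonneg) (auto simp: cm_seq_def divide_le_eq)
    finally show "0 \<le> (\<Sum>i\<le>degree p. coeff p i * (\<Sum>j\<le>N. real (N choose j) * (nabla ^^ (N - j)) a j * (real j / real N) ^ i))" .
  qed
qed

text \<open>
  The differences are the values at \<open>x^m (1 - x)^j\<close>. Up to a square, the parities of \<open>m\<close> and \<open>j\<close>
  leave the factors \<open>1\<close>, \<open>x\<close>, \<open>1 - x\<close> and \<open>x (1 - x)\<close>; since \<open>x + (1 - x) = 1\<close>, multiplying by
  this sum reduces the first and the last to the other two.
\<close>

lemma cm_seq_if_forms_nonneg:
  assumes X: "\<And>p. 0 \<le> moment a ([:0, 1:] * (p * p))"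
    and Y: "\<And>p. 0 \<le> moment a ([:1, -1:] * (p * p))"
  shows "cm_seq a"
  unfolding cm_seq_def nabla_funpow_moment
proof (intro allI)
  fix j m
  let ?x = "[:0, 1:] :: real poly" and ?y = "[:1, -1:] :: real poly"
  have xy: "?x + ?y = 1" by (simp add: one_pCons)
  define p where "p = ?x ^ (m div 2) * ?y ^ (j div 2)"
  have split: "q = ?x * q + ?y * q" for q
    by (simp only: distrib_right[symmetric] xy mult_1_left)
  have pw: "z ^ k = z ^ (k div 2) * z ^ (k div 2) * z ^ (k mod 2)" for z :: "real poly" and k
    by (metis mult_div_mod_eq mult_2 power_add)
  have eq: "?x ^ m * ?y ^ j = ?x ^ (m mod 2) * (?y ^ (j mod 2) * (p * p))"
    unfolding p_def by (subst (1) pw[of ?x m], subst (1) pw[of ?y j]) (simp only: mult_ac)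
  consider "m mod 2 = 0" "j mod 2 = 0" | "m mod 2 = 1" "j mod 2 = 0"
    | "m mod 2 = 0" "j mod 2 = 1" | "m mod 2 = 1" "j mod 2 = 1" by linarith
  then show "0 \<le> moment a (?x ^ m * ?y ^ j)"
  proof cases
    case 1
    have "0 \<le> moment a (?x * (p * p)) + moment a (?y * (p * p))" using X Y by (simp only: add_nonneg_nonneg)
    also have "\<dots> = moment a (p * p)" by (simp only: moment_add[symmetric] split[symmetric])
    finally show ?thesis unfolding eq by (simp only: 1 power_0 mult_1_left)
  next
    case 2 then show ?thesis unfolding eq using X by (simp only: 2 power_0 power_one_right mult_1_left)
  next
    case 3 then show ?thesis unfolding eq using Y by (simp only: 3 power_0 power_one_right mult_1_left)
  next
    case 4
    have "0 \<le> moment a (?x * ((?y * p) * (?y * p))) + moment a (?y * ((?x * p) * (?x * p)))"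
      using X Y by (simp only: add_nonneg_nonneg)
    also have "\<dots> = moment a (?y * (?x * ?y * (p * p)) + ?x * (?x * ?y * (p * p)))"
      by (simp only: moment_add mult_ac)
    also have "\<dots> = moment a (?x * ?y * (p * p))"
      by (simp only: add.commute split[symmetric])
    finally show ?thesis unfolding eq by (simp only: 4 power_one_right mult.assoc)
  qed
qed

section \<open>The resolvent of a power series\<close>

text \<open>
  The discrete form of \<open>1 / (g + l)\<close>, where \<open>g = s k^\<close>: the factor \<open>n (1 - X)\<close> is the backward
  difference quotient of step \<open>1 / n\<close> and plays the part of \<open>s\<close>.
\<close>

definition resolvent :: "real \<Rightarrow> real \<Rightarrow> real fps \<Rightarrow> real fps" where
  "resolvent n l A = inverse (fps_const n * (1 - fps_X) * A + fps_const l)"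

context
  fixes A :: "real fps" and n l :: real and U V :: "real fps"
  assumes n: "0 < n" and l: "0 < l" and A0: "0 \<le> A $ 0"
  defines "V \<equiv> resolvent n l A" and "U \<equiv> A * resolvent n l A"
begin

lemma resolvent_mult: "V * (fps_const n * (1 - fps_X) * A + fps_const l) = 1"
proof -
  have "0 < n * A $ 0 + l" using n l A0 by (simp add: add_nonneg_pos)
  then show ?thesis
    unfolding V_def resolvent_def by (intro inverse_mult_eq_1) simp
qed

text \<open>
  The discrete form of \<open>s u^ + l v^ = 1\<close>, that is, of \<open>u' = - l v\<close> with \<open>u(0) = 1\<close>.
\<close>

lemma resolvent_balance: "fps_const n * (1 - fps_X) * U + fps_const l * V = 1"
proof -
  have "fps_const n * (1 - fps_X) * U + fps_const l * V = V * (fps_const n * (1 - fps_X) * A + fps_const l)"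
    unfolding U_def V_def by (simp add: algebra_simps)
  then show ?thesis by (simp only: resolvent_mult)
qed

lemma resolvent_balance_nth:
  "n * U $ 0 + l * V $ 0 = 1"
  "n * (U $ Suc m - U $ m) + l * V $ Suc m = 0"
proof -
  have eq: "fps_const n * U - fps_X * (fps_const n * U) + fps_const l * V = 1"
    using resolvent_balance by (simp add: algebra_simps)
  show "n * U $ 0 + l * V $ 0 = 1"
    using arg_cong[OF eq, of "\<lambda>f. f $ 0"] by simp
  show "n * (U $ Suc m - U $ m) + l * V $ Suc m = 0"
    using arg_cong[OF eq, of "\<lambda>f. f $ Suc m"] by (simp add: algebra_simps)
qed

text \<open>
  The product rule for the shift, regarded as the divided difference of a series between \<open>X\<close> and
  \<open>0\<close>.
\<close>

lemma shift_mult: "fps_shift 1 (F * G) = fps_shift 1 F * G + fps_const (F $ 0) * fps_shift 1 G"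
  for F G :: "real fps"
proof (rule fps_ext)
  fix k
  show "fps_shift 1 (F * G) $ k = (fps_shift 1 F * G + fps_const (F $ 0) * fps_shift 1 G) $ k"
    by (simp add: fps_mult_nth sum.atLeast0_atMost_Suc_shift if_distrib[of "\<lambda>x. x * _"]
        sum.delta cong: if_cong del: sum.cl_ivl_Suc)
qed

text \<open>
  Induction on \<open>j\<close>: shifting the first identity at \<open>j\<close> gives the second one, because \<open>W\<close>, the
  sum at \<open>j\<close>, has constant coefficient \<open>U $ j\<close> and the terms with that factor collapse by the
  shifted balance equation \<open>n shift U + l shift V = n U\<close>. Reinserting the balance of
  coefficients turns the second identity at \<open>j\<close> into the first one at \<open>Suc j\<close>.
\<close>

lemma shift_U:
  "fps_shift j U = fps_const (n * U $ j) * U + fps_const l * V * (\<Sum>q\<le>j. fps_const (V $ (j - q)) * fps_shift q A)"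
  and shift_Suc_U:
  "fps_shift (Suc j) U = fps_const (n * U $ j) * U + fps_const l * V * (\<Sum>q\<le>j. fps_const (V $ (j - q)) * fps_shift (Suc q) A)"
proof -
  have shVU: "fps_const n * fps_shift 1 U + fps_const l * fps_shift 1 V = fps_const n * U"
    by (rule fps_ext) (use resolvent_balance_nth(2) in \<open>simp add: algebra_simps\<close>)
  have UVA: "U = V * A" by (simp add: U_def V_def mult.commute)
  have step: "fps_shift (Suc j) U = fps_const (n * U $ j) * U + fps_const l * V * (\<Sum>q\<le>j. fps_const (V $ (j - q)) * fps_shift (Suc q) A)"
    if IH: "fps_shift j U = fps_const (n * U $ j) * U + fps_const l * V * (\<Sum>q\<le>j. fps_const (V $ (j - q)) * fps_shift q A)" for j
  proof -
    define W where "W = (\<Sum>q\<le>j. fps_const (V $ (j - q)) * fps_shift q A)"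
    have W0: "W $ 0 = U $ j"
      by (simp add: W_def fps_sum_nth UVA fps_mult_nth atLeast0AtMost)
         (rule sum.reindex_bij_witness[of _ "\<lambda>i. j - i" "\<lambda>i. j - i"]; simp)
    have shW: "fps_shift 1 W = (\<Sum>q\<le>j. fps_const (V $ (j - q)) * fps_shift (Suc q) A)"
      by (rule fps_ext) (simp add: W_def fps_sum_nth add.commute)
    have "fps_shift (Suc j) U = fps_shift 1 (fps_shift j U)"
      by (rule fps_ext) (simp add: algebra_simps)
    also have "fps_shift j U = fps_const (n * U $ j) * U + fps_const l * (W * V)"
      using IH by (simp add: W_def mult_ac)
    also have "fps_shift 1 (fps_const (n * U $ j) * U + fps_const l * (W * V))
       = fps_const (n * U $ j) * fps_shift 1 U + fps_const l * (fps_shift 1 W * V + fps_const (W $ 0) * fps_shift 1 V)"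
    proof -
      have "fps_shift 1 (fps_const (n * U $ j) * U + fps_const l * (W * V))
         = fps_const (n * U $ j) * fps_shift 1 U + fps_const l * fps_shift 1 (W * V)"
        by (rule fps_ext) simp
      then show ?thesis by (simp only: shift_mult)
    qed
    also have "\<dots> = fps_const (U $ j) * (fps_const n * fps_shift 1 U + fps_const l * fps_shift 1 V) + fps_const l * V * fps_shift 1 W"
      by (simp only: W0 fps_const_mult[symmetric]) (simp only: algebra_simps)
    also have "\<dots> = fps_const (n * U $ j) * U + fps_const l * V * fps_shift 1 W"
      by (simp only: shVU) (simp add: mult_ac fps_const_mult[symmetric] del: fps_const_mult)
    finally show ?thesis by (simp only: shW)
  qed
  show id1: "fps_shift j U = fps_const (n * U $ j) * U + fps_const l * V * (\<Sum>q\<le>j. fps_const (V $ (j - q)) * fps_shift q A)" for j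
  proof (induction j)
    case 0
    have "fps_const (n * U $ 0) * U + fps_const l * V * (fps_const (V $ 0) * A)
      = fps_const (n * U $ 0 + l * V $ 0) * U"
      by (simp add: UVA algebra_simps fps_const_mult[symmetric] fps_const_add[symmetric] del: fps_const_mult fps_const_add)
    then show ?case by (simp add: resolvent_balance_nth)
  next
    case (Suc j)
    have "(\<Sum>q\<le>Suc j. fps_const (V $ (Suc j - q)) * fps_shift q A)
       = fps_const (V $ Suc j) * A + (\<Sum>q\<le>j. fps_const (V $ (j - q)) * fps_shift (Suc q) A)"
      by (subst sum.atMost_Suc_shift) simp
    then have "fps_const (n * U $ Suc j) * U + fps_const l * V * (\<Sum>q\<le>Suc j. fps_const (V $ (Suc j - q)) * fps_shift q A)
      = fps_const (n * U $ Suc j + l * V $ Suc j) * U + fps_const l * V * (\<Sum>q\<le>j. fps_const (V $ (j - q)) * fps_shift (Suc q) A)"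
      by (simp add: UVA algebra_simps fps_const_mult[symmetric] fps_const_add[symmetric] del: fps_const_mult fps_const_add)
    also have "n * U $ Suc j + l * V $ Suc j = n * U $ j"
      using resolvent_balance_nth(2)[of j] by (simp add: algebra_simps)
    finally show ?case using step[OF Suc.IH] by simp
  qed
  show "fps_shift (Suc j) U = fps_const (n * U $ j) * U + fps_const l * V * (\<Sum>q\<le>j. fps_const (V $ (j - q)) * fps_shift (Suc q) A)"
    by (rule step[OF id1])
qed

lemma hankel_nth:
  assumes "F = fps_const c * U + fps_const l * V * (\<Sum>q\<le>j. fps_const (V $ (j - q)) * fps_shift (q + e) A)"
  shows "F $ i = c * U $ i + l * (\<Sum>p\<le>i. \<Sum>q\<le>j. V $ (i - p) * V $ (j - q) * A $ (p + q + e))"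
proof -
  have "(V * (\<Sum>q\<le>j. fps_const (V $ (j - q)) * fps_shift (q + e) A)) $ i
     = (\<Sum>p=0..i. V $ (i - p) * (\<Sum>q\<le>j. V $ (j - q) * A $ (p + (q + e))))"
    by (subst mult.commute, subst fps_mult_nth) (simp add: fps_sum_nth mult.commute)
  also have "\<dots> = (\<Sum>p\<le>i. \<Sum>q\<le>j. V $ (i - p) * V $ (j - q) * A $ (p + q + e))"
    by (simp add: mult.assoc sum_distrib_left atLeast0AtMost add.assoc)
  finally show ?thesis
    unfolding assms by (simp only: mult.assoc fps_add_nth fps_mult_left_const_nth)
qed

text \<open>
  Together with \<open>hankel_nabla\<close> this exhibits the two Hankel matrices of \<open>U\<close> as \<open>l T H T\<^sup>t\<close> plus,
  here, a matrix of rank one, where \<open>T\<close> is the lower triangular Toeplitz matrix of \<open>V\<close> and \<open>H\<close>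
  is the corresponding Hankel matrix of \<open>A\<close>.
\<close>

lemma hankel_Suc:
  "U $ Suc (i + j) = n * U $ i * U $ j + l * (\<Sum>p\<le>i. \<Sum>q\<le>j. V $ (i - p) * V $ (j - q) * A $ (Suc (p + q)))"
proof -
  have "fps_shift (Suc j) U $ i = n * U $ j * U $ i
      + l * (\<Sum>p\<le>i. \<Sum>q\<le>j. V $ (i - p) * V $ (j - q) * A $ (p + q + 1))"
    by (rule hankel_nth) (subst shift_Suc_U, simp)
  then show ?thesis by (simp add: mult_ac)
qed

lemma hankel_nabla:
  "nabla (($) U) (i + j) = l * (\<Sum>p\<le>i. \<Sum>q\<le>j. V $ (i - p) * V $ (j - q) * nabla (($) A) (p + q))"
proof -
  have "fps_shift j U $ i = n * U $ j * U $ i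
      + l * (\<Sum>p\<le>i. \<Sum>q\<le>j. V $ (i - p) * V $ (j - q) * A $ (p + q + 0))"
    by (rule hankel_nth) (subst shift_U, simp)
  then show ?thesis
    using hankel_Suc[of i j] by (simp add: nabla_def right_diff_distrib sum_subtractf mult_ac)
qed

text \<open>
  Positivity passes through the congruence: the form at \<open>p\<close> becomes a multiple of a square plus
  \<open>l\<close> times the form at the polynomial \<open>Q\<close> whose coefficient vector is \<open>T\<^sup>t\<close> applied to that of
  \<open>p\<close>.
\<close>

lemma hankel_form:
  fixes b c :: "nat \<Rightarrow> real"
  assumes c: "\<And>i j. c (i + j) = r * U $ i * U $ j + l * (\<Sum>p\<le>i. \<Sum>q\<le>j. V $ (i - p) * V $ (j - q) * b (p + q))"
    and r: "0 \<le> r" and b: "\<And>p. 0 \<le> moment b (p * p)"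
  shows "0 \<le> moment c (p * p)"
proof -
  define N where "N = Suc (degree p)"
  define x where "x = coeff p"
  define y where "y k = (\<Sum>i<N. if k \<le> i then x i * V $ (i - k) else 0)" for k
  \<comment> \<open>The polynomial with coefficient vector \<open>y = T\<^sup>t x\<close>.\<close>
  define Q where "Q = (\<Sum>k<N. monom (y k) k)"
  have cQ: "coeff Q k = (if k < N then y k else 0)" for k
    by (simp add: Q_def coeff_sum if_distrib cong: if_cong) 
  have dQ: "degree Q < N"
    unfolding N_def less_Suc_eq_le by (rule degree_le) (simp add: cQ N_def)
  have "moment c (p * p) = (\<Sum>i<N. \<Sum>j<N. x i * x j * c (i + j))"
    by (simp add: moment_mult[of p N p] N_def x_def)
  also have "\<dots> = r * (\<Sum>i<N. x i * U $ i) ^ 2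
     + l * (\<Sum>i<N. \<Sum>j<N. x i * x j * (\<Sum>p\<le>i. \<Sum>q\<le>j. V $ (i - p) * V $ (j - q) * b (p + q)))"
    by (simp add: c power2_eq_square sum_product sum_distrib_left sum.distrib distrib_left mult_ac)
  also have "(\<Sum>i<N. \<Sum>j<N. x i * x j * (\<Sum>p\<le>i. \<Sum>q\<le>j. V $ (i - p) * V $ (j - q) * b (p + q)))
     = (\<Sum>i<N. \<Sum>j<N. x i * x j * (\<Sum>p<N. \<Sum>q<N. (if p \<le> i then V $ (i - p) else 0) * (if q \<le> j then V $ (j - q) else 0) * b (p + q)))"
  proof (rule sum.cong[OF refl], rule sum.cong[OF refl], rule arg_cong2[where f="(*)", OF refl])
    fix i j assume ij: "i \<in> {..<N}" "j \<in> {..<N}"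
    have "(\<Sum>p\<le>i. \<Sum>q\<le>j. V $ (i - p) * V $ (j - q) * b (p + q))
      = (\<Sum>p\<le>i. \<Sum>q<N. V $ (i - p) * (if q \<le> j then V $ (j - q) else 0) * b (p + q))"
      by (intro sum.cong refl sum.mono_neutral_cong_left) (use ij in auto)
    also have "\<dots> = (\<Sum>p<N. \<Sum>q<N. (if p \<le> i then V $ (i - p) else 0) * (if q \<le> j then V $ (j - q) else 0) * b (p + q))"
      by (intro sum.mono_neutral_cong_left) (use ij in auto)
    finally show "(\<Sum>p\<le>i. \<Sum>q\<le>j. V $ (i - p) * V $ (j - q) * b (p + q))
      = (\<Sum>p<N. \<Sum>q<N. (if p \<le> i then V $ (i - p) else 0) * (if q \<le> j then V $ (j - q) else 0) * b (p + q))" .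
  qed
  also have "\<dots> = (\<Sum>p<N. \<Sum>q<N. y p * y q * b (p + q))"
  proof -
    define w where "w i p = x i * (if p \<le> i then V $ (i - p) else 0)" for i p
    have yw: "y p = (\<Sum>i<N. w i p)" for p unfolding y_def w_def by (intro sum.cong) auto
    have "(\<Sum>i<N. \<Sum>j<N. x i * x j * (\<Sum>p<N. \<Sum>q<N. (if p \<le> i then V $ (i - p) else 0) * (if q \<le> j then V $ (j - q) else 0) * b (p + q)))
        = (\<Sum>i<N. \<Sum>j<N. \<Sum>p<N. \<Sum>q<N. w i p * w j q * b (p + q))"
      unfolding sum_distrib_left w_def by (intro sum.cong refl) (simp only: mult_ac)
    also have "\<dots> = (\<Sum>i<N. \<Sum>p<N. \<Sum>j<N. \<Sum>q<N. w i p * w j q * b (p + q))"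
      by (intro sum.cong refl sum.swap)
    also have "\<dots> = (\<Sum>p<N. \<Sum>i<N. \<Sum>j<N. \<Sum>q<N. w i p * w j q * b (p + q))"
      by (rule sum.swap)
    also have "\<dots> = (\<Sum>p<N. \<Sum>i<N. \<Sum>q<N. \<Sum>j<N. w i p * w j q * b (p + q))"
      by (intro sum.cong refl sum.swap)
    also have "\<dots> = (\<Sum>p<N. \<Sum>q<N. \<Sum>i<N. \<Sum>j<N. w i p * w j q * b (p + q))"
      by (intro sum.cong refl sum.swap)
    finally show ?thesis by (simp only: yw sum_product) (simp only: sum_distrib_right)
  qed
  also have "\<dots> = moment b (Q * Q)"
    by (simp add: moment_mult[OF dQ dQ] cQ)
  finally show ?thesis using b[of Q] r l by simp
qed

text \<open>
  The forms \<open>x p^2\<close> and \<open>(1 - x) p^2\<close> are nonnegative on the unit interval, hence nonnegative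
  for \<open>A\<close>, hence for \<open>U\<close>, and these two forms suffice.
\<close>

lemma cm_seq_resolvent:
  assumes "cm_seq (($) A)"
  shows "cm_seq (($) U)"
proof (rule cm_seq_if_forms_nonneg)
  fix p :: "real poly"
  have sq: "0 \<le> poly (p * p) x" for p :: "real poly" and x by simp
  have "0 \<le> moment (\<lambda>i. U $ Suc i) (p * p)"
  proof (rule hankel_form[where b="\<lambda>i. A $ Suc i" and r=n])
    show "0 \<le> moment (\<lambda>i. A $ Suc i) (p * p)" for p
      unfolding moment_shift by (rule cm_seq_moment_nonneg[OF assms]) (simp add: mult_nonneg_nonneg)
  qed (use n hankel_Suc in auto)
  then show "0 \<le> moment (($) U) ([:0, 1:] * (p * p))" by (simp only: moment_shift)
  have "0 \<le> moment (nabla (($) U)) (p * p)"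
  proof (rule hankel_form[where b="nabla (($) A)" and r=0])
    show "0 \<le> moment (nabla (($) A)) (p * p)" for p
      unfolding moment_nabla by (rule cm_seq_moment_nonneg[OF assms]) (use mult_nonneg_nonneg[OF _ sq[of p]] in \<open>auto simp: algebra_simps mult_left_le_one_le zero_le_mult_iff\<close>)
  qed (use hankel_nabla in auto)
  then show "0 \<le> moment (($) U) ([:1, -1:] * (p * p))" by (simp only: moment_nabla)
qed

text \<open>
  By the balance of coefficients, \<open>l V $ Suc k\<close> is \<open>n\<close> times a difference of the decreasing
  sequence \<open>U\<close>.
\<close>

lemma resolvent_nonneg:
  assumes "cm_seq (($) A)"
  shows "0 \<le> V $ m"
proof -
  have "0 \<le> l * V $ m"
  proof (cases m)
    case 0
    have "V $ 0 = inverse (n * A $ 0 + l)" by (simp add: V_def resolvent_def)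
    then have "0 \<le> V $ 0" using n l A0 by simp
    then show ?thesis using 0 l by simp
  next
    case (Suc k)
    have "0 \<le> (nabla ^^ 1) (($) U) k" using cm_seq_resolvent[OF assms] unfolding cm_seq_def by blast
    then have "0 \<le> n * (U $ k - U $ Suc k)" using n by (simp add: nabla_def)
    also have "\<dots> = l * V $ Suc k" using resolvent_balance_nth(2)[of k] by (simp add: algebra_simps)
    finally show ?thesis using Suc by simp
  qed
  then show ?thesis using l by (simp add: zero_le_mult_iff)
qed

end

text \<open>
  The resolvent identity \<open>W - V = (l - l1) V W\<close>, with nonnegative coefficients on the right.
\<close>

lemma resolvent_antitone:
  assumes n: "0 < n" and l: "0 < l1" "l1 \<le> l" and A: "cm_seq (($) A)"
  shows "resolvent n l A $ m \<le> resolvent n l1 A $ m"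
    and "(A * resolvent n l A) $ m \<le> (A * resolvent n l1 A) $ m"
proof -
  have A0: "0 \<le> A $ m" for m using A[unfolded cm_seq_def, rule_format, of 0 m] by simp
  have l': "0 < l" using l by simp
  let ?V = "resolvent n l A" and ?W = "resolvent n l1 A" and ?B = "fps_const n * (1 - fps_X) * A"
  have "?W - ?V = ?W * (?V * (?B + fps_const l)) - ?V * (?W * (?B + fps_const l1))"
    by (simp only: resolvent_mult[OF n l' A0] resolvent_mult[OF n l(1) A0] mult_1_right)
  also have "\<dots> = (fps_const l - fps_const l1) * (?V * ?W)" by (simp only: algebra_simps)
  finally have d: "?W - ?V = fps_const (l - l1) * (?V * ?W)" by simp
  have V0: "0 \<le> ?V $ i" "0 \<le> ?W $ i" for i
    using resolvent_nonneg[OF n l' A0 A] resolvent_nonneg[OF n l(1) A0 A] by auto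
  have VW: "0 \<le> (?V * ?W) $ i" for i
    unfolding fps_mult_nth by (intro sum_nonneg mult_nonneg_nonneg V0)
  have dm: "(?W - ?V) $ i \<ge> 0" for i unfolding d using VW l by simp
  show "?V $ m \<le> ?W $ m" using dm[of m] by simp
  have "0 \<le> (A * (?W - ?V)) $ m"
    unfolding fps_mult_nth using dm A0 by (intro sum_nonneg mult_nonneg_nonneg) auto
  then show "(A * ?V) $ m \<le> (A * ?W) $ m" by (simp add: right_diff_distrib)
qed

section \<open>Poisson means of a completely monotone sequence\<close>

lemma cm_seq_nabla: "cm_seq b \<Longrightarrow> cm_seq (nabla b)"
  unfolding cm_seq_def by (metis comp_apply funpow_Suc_right)

lemma cm_seq_nabla_funpow: "cm_seq b \<Longrightarrow> cm_seq ((nabla ^^ j) b)"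
  by (induction j) (auto intro: cm_seq_nabla)

lemma cm_seq_nonneg: "cm_seq b \<Longrightarrow> 0 \<le> b m"
  unfolding cm_seq_def by (metis funpow_0)

lemma cm_seq_Suc_le: "cm_seq b \<Longrightarrow> b (Suc m) \<le> b m"
  using cm_seq_nonneg[OF cm_seq_nabla[of b], of m] by (simp add: nabla_def)

lemma cm_seq_le_0: "cm_seq b \<Longrightarrow> b m \<le> b 0"
  by (induction m) (auto intro: order_trans[OF cm_seq_Suc_le])

text \<open>
  The exponential series is chosen because \<open>nabla b\<close> then corresponds to the series minus its
  derivative.
\<close>

definition expgen :: "(nat \<Rightarrow> real) \<Rightarrow> complex fps" where
  "expgen b = Abs_fps (\<lambda>m. of_real (b m / fact m))"

text \<open>
  The Szasz operator: the mean of \<open>b\<close> under the Poisson distribution with parameter \<open>n z\<close>,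
  continued to complex \<open>z\<close>.
\<close>

definition szasz :: "real \<Rightarrow> (nat \<Rightarrow> real) \<Rightarrow> complex \<Rightarrow> complex" where
  "szasz n b z = exp (- (of_real n * z)) * eval_fps (expgen b) (of_real n * z)"

definition szasz_real :: "real \<Rightarrow> (nat \<Rightarrow> real) \<Rightarrow> real \<Rightarrow> real" where
  "szasz_real n b t = exp (- (n * t)) * (\<Sum>m. b m / fact m * (n * t) ^ m)"

lemma summable_expgen:
  fixes x :: real
  assumes "cm_seq b"
  shows "summable (\<lambda>m. b m / fact m * x ^ m)"
proof (rule summable_comparison_test[OF _ summable_mult[of "\<lambda>m. \<bar>x\<bar> ^ m / fact m" "b 0"]])
  show "summable (\<lambda>m. \<bar>x\<bar> ^ m / fact m)"
    using summable_exp[of "\<bar>x\<bar>"] by (simp add: divide_inverse mult.commute)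
  show "\<exists>N. \<forall>m\<ge>N. norm (b m / fact m * x ^ m) \<le> b 0 * (\<bar>x\<bar> ^ m / fact m)"
    using cm_seq_nonneg[OF assms] cm_seq_le_0[OF assms]
    by (auto simp: abs_mult power_abs intro!: divide_right_mono mult_right_mono)
qed

lemma conv_radius_expgen:
  assumes "cm_seq b"
  shows "fps_conv_radius (expgen b) = \<infinity>"
  unfolding fps_conv_radius_def
proof (rule conv_radius_inftyI'')
  fix z :: complex
  have "summable (\<lambda>m. norm (fps_nth (expgen b) m * z ^ m))"
    using summable_expgen[OF assms, of "norm z"] cm_seq_nonneg[OF assms]
    by (simp add: expgen_def norm_mult norm_power norm_divide)
  then show "summable (\<lambda>m. fps_nth (expgen b) m * z ^ m)" by (rule summable_norm_cancel)
qed

lemma szasz_of_real: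
  assumes "cm_seq b"
  shows "szasz n b (of_real t) = of_real (szasz_real n b t)"
proof -
  have "(\<lambda>m. complex_of_real (b m / fact m * (n * t) ^ m)) sums of_real (\<Sum>m. b m / fact m * (n * t) ^ m)"
    by (intro sums_of_real summable_sums summable_expgen assms)
  then have "eval_fps (expgen b) (of_real n * of_real t) = of_real (\<Sum>m. b m / fact m * (n * t) ^ m)"
    unfolding eval_fps_def expgen_def by (intro sums_unique[symmetric]) simp
  then show ?thesis
    unfolding szasz_def szasz_real_def by (simp add: exp_of_real[symmetric])
qed

lemma szasz_deriv:
  assumes "cm_seq b"
  shows "(szasz n b has_field_derivative - of_real n * szasz n (nabla b) z) (at z)"
proof -
  let ?w = "of_real n * z"
  have nb: "expgen (nabla b) = expgen b - fps_deriv (expgen b)"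
    by (rule fps_ext) (simp add: expgen_def nabla_def field_simps del: of_nat_Suc)
  have E: "eval_fps (expgen (nabla b)) ?w = eval_fps (expgen b) ?w - eval_fps (fps_deriv (expgen b)) ?w"
    unfolding nb using conv_radius_expgen[OF assms] fps_conv_radius_deriv[of "expgen b"]
    by (intro eval_fps_diff) auto
  have "(eval_fps (expgen b) has_field_derivative eval_fps (fps_deriv (expgen b)) ?w) (at ?w)"
    by (rule has_field_derivative_eval_fps) (simp add: conv_radius_expgen[OF assms])
  then have "((\<lambda>z. eval_fps (expgen b) (of_real n * z)) has_field_derivative
      eval_fps (fps_deriv (expgen b)) ?w * of_real n) (at z)"
    by (rule DERIV_chain2) (auto intro!: derivative_eq_intros)
  then show ?thesis
    unfolding szasz_def E by (auto intro!: derivative_eq_intros simp: algebra_simps conv_radius_expgen[OF assms])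
qed

lemma higher_deriv_szasz:
  assumes "cm_seq b"
  shows "(deriv ^^ j) (szasz n b) = (\<lambda>z. (- of_real n) ^ j * szasz n ((nabla ^^ j) b) z)"
proof (induction j)
  case (Suc j)
  have "((\<lambda>z. (- of_real n) ^ j * szasz n ((nabla ^^ j) b) z) has_field_derivative
      (- of_real n) ^ Suc j * szasz n ((nabla ^^ Suc j) b) z) (at z)" for z
    using DERIV_cmult[OF szasz_deriv[OF cm_seq_nabla_funpow[OF assms]], of "(- of_real n) ^ j"]
    by (simp add: algebra_simps)
  then show ?case by (auto simp: Suc.IH fun_eq_iff intro!: DERIV_imp_deriv)
qed simp

lemma szasz_holomorphic: "cm_seq b \<Longrightarrow> szasz n b holomorphic_on S"
  unfolding holomorphic_on_def field_differentiable_def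
  by (blast intro: szasz_deriv DERIV_subset)

lemma szasz_real_mono:
  assumes "cm_seq b" "cm_seq c" "\<And>m. b m \<le> c m" "0 \<le> n" "0 \<le> t"
  shows "szasz_real n b t \<le> szasz_real n c t"
  unfolding szasz_real_def
  by (intro mult_left_mono suminf_le summable_expgen assms mult_right_mono divide_right_mono) (use assms in auto)

lemma szasz_real_nonneg:
  assumes "cm_seq b" "0 \<le> n" "0 \<le> t"
  shows "0 \<le> szasz_real n b t"
  unfolding szasz_real_def
  by (intro mult_nonneg_nonneg suminf_nonneg summable_expgen assms) (use assms cm_seq_nonneg in auto)

lemma szasz_real_le:
  assumes "cm_seq b" "0 \<le> n" "0 \<le> t"
  shows "szasz_real n b t \<le> b 0"
proof -
  have "(\<Sum>m. b m / fact m * (n * t) ^ m) \<le> (\<Sum>m. b 0 * ((n * t) ^ m / fact m))"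
  proof (rule suminf_le)
    show "summable (\<lambda>m. b 0 * ((n * t) ^ m / fact m))"
      using summable_exp[of "n * t"] by (intro summable_mult) (simp add: divide_inverse mult.commute)
    show "b m / fact m * (n * t) ^ m \<le> b 0 * ((n * t) ^ m / fact m)" for m
      using assms cm_seq_le_0[OF assms(1), of m] by (auto intro!: divide_right_mono mult_right_mono)
  qed (rule summable_expgen[OF assms(1)])
  also have "\<dots> = b 0 * exp (n * t)"
    unfolding exp_def using summable_exp[of "n * t"]
    by (subst suminf_mult) (auto simp: divide_inverse mult.commute)
  finally show ?thesis
    unfolding szasz_real_def by (simp add: exp_minus field_simps)
qed

text \<open>
  A completely monotone function has derivatives of alternating sign, so in modulus the Taylor
  series around a real point \<open>t\<close>, evaluated at \<open>z\<close>, is dominated by its own value at the real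
  point \<open>t - r\<close>, where \<open>r = \<bar>z - t\<bar>\<close>. For \<open>Re z > 0\<close> and \<open>t\<close> large, \<open>t - r\<close> is positive and the
  value there is at most \<open>b 0\<close>.
\<close>

lemma norm_szasz_le:
  assumes b: "cm_seq b" and n: "0 \<le> n" and z: "0 < Re z"
  shows "norm (szasz n b z) \<le> b 0"
proof -
  \<comment> \<open>The disc around \<open>t\<close> through \<open>0\<close> contains \<open>z\<close> as soon as \<open>2 t Re z > \<bar>z\<bar>^2\<close>.\<close>
  define t where "t = (norm z) ^ 2 / Re z"
  define r where "r = norm (z - of_real t)"
  have z2: "0 < (norm z)^2" using z by auto
  have t0: "0 < t" using z z2 by (simp add: t_def)
  have "r ^ 2 = (norm z)^2 - 2 * t * Re z + t ^ 2"
    unfolding r_def cmod_power2 by (simp add: power2_eq_square algebra_simps)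
  also have "\<dots> = t ^ 2 - (norm z)^2" using z by (simp add: t_def)
  finally have "r ^ 2 < t ^ 2" using z2 by linarith
  then have rt: "r < t" by (rule power2_less_imp_less) (use t0 in linarith)
  have r0: "0 \<le> r" by (simp add: r_def)
  have hol: "szasz n b holomorphic_on ball (of_real t) t" by (rule szasz_holomorphic[OF b])
  define T where "T j = n ^ j * szasz_real n ((nabla ^^ j) b) t / fact j * r ^ j" for j
  have der: "(deriv ^^ j) (szasz n b) (of_real t) = of_real ((- n) ^ j * szasz_real n ((nabla ^^ j) b) t)" for j
    unfolding higher_deriv_szasz[OF b] by (simp add: szasz_of_real[OF cm_seq_nabla_funpow[OF b]])
  have s1: "(\<lambda>j. (deriv ^^ j) (szasz n b) (of_real t) / fact j * (z - of_real t) ^ j) sums szasz n b z"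
    by (rule holomorphic_power_series[OF hol]) (use rt in \<open>simp add: r_def dist_norm norm_minus_commute\<close>)
  have nrm: "norm ((deriv ^^ j) (szasz n b) (of_real t) / fact j * (z - of_real t) ^ j) = T j" for j
  proof -
    have "norm ((- n) ^ j * szasz_real n ((nabla ^^ j) b) t) = n ^ j * szasz_real n ((nabla ^^ j) b) t"
      using n t0 szasz_real_nonneg[OF cm_seq_nabla_funpow[OF b]] by (simp add: abs_mult power_abs)
    moreover have "norm (complex_of_real y / fact j * w ^ j) = norm y / fact j * norm w ^ j" for y w
      by (simp only: norm_mult norm_divide norm_power norm_of_real norm_fact real_norm_def)
    ultimately show ?thesis unfolding der T_def r_def by (simp only:)
  qed
  have s2: "(\<lambda>j. (deriv ^^ j) (szasz n b) (of_real t) / fact j * (of_real (t - r) - of_real t) ^ j)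
      sums szasz n b (of_real (t - r))"
    by (rule holomorphic_power_series[OF hol]) (use rt r0 in \<open>simp add: dist_norm\<close>)
  moreover have "(deriv ^^ j) (szasz n b) (of_real t) / fact j * (of_real (t - r) - of_real t) ^ j = of_real (T j)" for j
  proof -
    have "(- n) ^ j * (- r) ^ j = n ^ j * r ^ j"
      by (simp only: power_mult_distrib[symmetric]) simp
    then have "(- n) ^ j * szasz_real n ((nabla ^^ j) b) t / fact j * (- r) ^ j = T j"
      unfolding T_def by (simp add: mult_ac)
    moreover have "complex_of_real y / fact j * (of_real (t - r) - of_real t) ^ j = of_real (y / fact j * (- r) ^ j)" for y
      by simp
    ultimately show ?thesis unfolding der by (simp only:)
  qed
  ultimately have "(\<lambda>j. complex_of_real (T j)) sums of_real (szasz_real n b (t - r))"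
    by (simp only: szasz_of_real[OF b])
  then have Ts: "T sums szasz_real n b (t - r)" by (simp only: sums_of_real_iff)
  have "norm (szasz n b z) \<le> (\<Sum>j. T j)"
    unfolding sums_unique[OF s1] using Ts nrm by (intro order_trans[OF summable_norm]) (auto simp: sums_iff)
  also have "\<dots> = szasz_real n b (t - r)" using Ts by (simp add: sums_iff)
  also have "\<dots> \<le> b 0" using rt by (intro szasz_real_le b n) simp
  finally show ?thesis .
qed

text \<open>
  The normalisation of the Erlang density.
\<close>

lemma laplace_power:
  assumes "0 < (l::real)"
  shows "has_bochner_integral lebesgue (\<lambda>t. indicator {0<..} t * (t ^ m / fact m * exp (- l * t))) (1 / l ^ Suc m)"
proof -
  have "has_bochner_integral lborel (erlang_density m l) 1"
    by (rule has_bochner_integral_nn_integral)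
       (use nn_integral_erlang_ith_moment[OF assms, of m 0] assms in auto)
  then have "has_bochner_integral lborel (\<lambda>t. erlang_density m l t / l ^ Suc m) (1 / l ^ Suc m)"
    by (rule has_bochner_integral_divide_zero)
  then have 1: "has_bochner_integral lebesgue (\<lambda>t. erlang_density m l t / l ^ Suc m) (1 / l ^ Suc m)"
    unfolding has_bochner_integral_iff by (simp add: integrable_completion integral_completion)
  have ae: "AE t in lebesgue. indicator {0<..} t * (t ^ m / fact m * exp (- l * t)) = erlang_density m l t / l ^ Suc m"
  proof -
    have "AE t in lebesgue. t \<notin> {0::real}" by (rule AE_not_in) auto
    then show ?thesis
      by (rule AE_mp) (rule AE_I2, use assms in \<open>auto simp: erlang_density_def indicator_def field_simps\<close>)
  qed
  have m: "(\<lambda>t. indicator {0<..} t * (t ^ m / fact m * exp (- l * t))) \<in> borel_measurable lebesgue"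
    by (rule measurable_completion) measurable
  show ?thesis
    using has_bochner_integral_cong_AE[OF m borel_measurable_has_bochner_integral[OF 1] ae] 1 by simp
qed

text \<open>
  Integrated term by term: the Poisson weight of \<open>m\<close> has transform \<open>n^m / (s + n)^(m + 1)\<close>, so
  the transform is the ordinary generating function of \<open>b\<close> at \<open>n / (s + n)\<close>.
\<close>

lemma laplace_szasz:
  assumes b: "cm_seq b" and n: "0 < n" and s: "0 < s"
  shows "laplace_exists (szasz_real n b) s"
    and "(\<lambda>m. b m * (n / (s + n)) ^ m) sums ((s + n) * laplace (szasz_real n b) s)"
proof -
  define f where "f m t = b m * n ^ m * (indicator {0<..} t * (t ^ m / fact m * exp (- (s + n) * t)))" for m and t :: real
  have f1: "has_bochner_integral lebesgue (f m) (b m * n ^ m * (1 / (s + n) ^ Suc m))" for m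
    unfolding f_def by (intro has_bochner_integral_mult_right laplace_power) (use n s in auto)
  have f0: "0 \<le> f m t" for m t
    unfolding f_def using n cm_seq_nonneg[OF b] by (auto simp: indicator_def)
  have fsum: "(\<lambda>m. f m t) sums (indicator {0<..} t * (exp (- s * t) * szasz_real n b t))" for t
  proof -
    have "(\<lambda>m. indicator {0<..} t * exp (- s * t) * exp (- (n * t)) * (b m / fact m * (n * t) ^ m)) sums
      (indicator {0<..} t * exp (- s * t) * exp (- (n * t)) * (\<Sum>m. b m / fact m * (n * t) ^ m))"
      by (intro sums_mult summable_sums summable_expgen b)
    moreover have "exp (- s * t) * exp (- (n * t)) = exp (- (s + n) * t)"
      by (simp add: exp_add[symmetric] algebra_simps)
    ultimately show ?thesis
      unfolding f_def szasz_real_def by (simp add: mult_ac power_mult_distrib)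
  qed
  have eqsum: "(\<lambda>t. \<Sum>m. f m t) = (\<lambda>t. indicator {0<..} t * (exp (- s * t) * szasz_real n b t))"
    using fsum by (auto simp: sums_iff fun_eq_iff)
  have q: "0 \<le> n / (s + n)" "n / (s + n) < 1" using n s by auto
  have int: "integral\<^sup>L lebesgue (f m) = b m * (n / (s + n)) ^ m / (s + n)" for m
    using f1[of m] by (simp add: has_bochner_integral_iff power_divide mult_ac)
  have sm: "summable (\<lambda>m. b m * (n / (s + n)) ^ m / (s + n))"
  proof (rule summable_divide, rule summable_comparison_test[OF _ summable_mult[OF summable_geometric]])
    show "\<exists>N. \<forall>m\<ge>N. norm (b m * (n / (s + n)) ^ m) \<le> b 0 * (n / (s + n)) ^ m"
      using cm_seq_nonneg[OF b] cm_seq_le_0[OF b] q by (simp add: abs_mult power_abs mult_right_mono del: power_divide abs_divide)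
  qed (use q in \<open>simp only: real_norm_def abs_of_nonneg\<close>)
  have A1: "integrable lebesgue (f m)" for m using f1 by (simp add: has_bochner_integral_iff)
  have A2: "AE t in lebesgue. summable (\<lambda>m. norm (f m t))"
    using fsum f0 by (auto simp: sums_iff)
  have A3: "summable (\<lambda>m. \<integral>t. norm (f m t) \<partial>lebesgue)"
    using sm int f0 by simp
  show "laplace_exists (szasz_real n b) s"
    using integrable_suminf[OF A1 A2 A3]
    unfolding eqsum laplace_exists_def set_integrable_def by simp
  have "(\<lambda>m. (s + n) * (b m * (n / (s + n)) ^ m / (s + n))) sums ((s + n) * laplace (szasz_real n b) s)"
    using sums_integral[OF A1 A2 A3]
    unfolding eqsum int laplace_def set_lebesgue_integral_def by (intro sums_mult) simp
  then show "(\<lambda>m. b m * (n / (s + n)) ^ m) sums ((s + n) * laplace (szasz_real n b) s)"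
    using n s by simp
qed

section \<open>Sampling a completely monotone function\<close>

lemma higher_deriv_eq:
  assumes "\<And>t. 0 < t \<Longrightarrow> f t = g t" "0 < (t::real)"
  shows "(deriv ^^ n) f t = (deriv ^^ n) g t"
proof (rule higher_deriv_cong_ev[OF _ refl])
  have "eventually (\<lambda>x. x \<in> {0<..}) (nhds t)"
    using assms(2) by (intro eventually_nhds_in_open) auto
  then show "\<forall>\<^sub>F x in nhds t. f x = g x"
    by eventually_elim (use assms(1) in auto)
qed

lemma completely_monotone_cong:
  assumes "\<And>t. 0 < t \<Longrightarrow> f t = g t" "completely_monotone f"
  shows "completely_monotone g"
  unfolding completely_monotone_def
proof (intro allI impI)
  fix n and t :: real assume t: "0 < t"
  have eq: "(deriv ^^ n) f x = (deriv ^^ n) g x" if "0 < x" for x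
    by (rule higher_deriv_eq) (use assms(1) that in auto)
  have f: "(deriv ^^ n) f differentiable (at t)" "0 \<le> (- 1) ^ n * (deriv ^^ n) f t"
    using assms(2) t unfolding completely_monotone_def by auto
  then obtain d where "((deriv ^^ n) f has_real_derivative d) (at t)"
    by (auto simp: real_differentiable_def)
  then have "((deriv ^^ n) g has_real_derivative d) (at t)"
    by (rule has_field_derivative_transform_within_open[of _ _ _ "{0<..}"]) (use t eq in auto)
  then show "(deriv ^^ n) g differentiable (at t) \<and> 0 \<le> (- 1) ^ n * (deriv ^^ n) g t"
    using f(2) eq[OF t] by (auto simp: real_differentiable_def)
qed

lemma completely_monotone_deriv:
  assumes "completely_monotone f" "0 < t"
  shows "((deriv ^^ n) f has_real_derivative (deriv ^^ Suc n) f t) (at t)"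
  using assms unfolding completely_monotone_def by (simp add: DERIV_deriv_iff_real_differentiable)

lemma completely_monotone_nonneg:
  assumes "completely_monotone f" "0 < t"
  shows "0 \<le> f t"
  using assms(1)[unfolded completely_monotone_def, rule_format, OF assms(2), of 0] by simp

lemma completely_monotone_higher_antimono:
  assumes f: "completely_monotone f" and st: "0 < s" "s \<le> t"
  shows "(- 1) ^ n * (deriv ^^ n) f t \<le> (- 1) ^ n * (deriv ^^ n) f s"
proof (rule DERIV_nonpos_imp_nonincreasing[OF st(2)])
  fix x assume "s \<le> x" "x \<le> t"
  then have x: "0 < x" using st by simp
  have "((\<lambda>x. (- 1) ^ n * (deriv ^^ n) f x) has_real_derivative (- 1) ^ n * (deriv ^^ Suc n) f x) (at x)"
    by (intro DERIV_cmult completely_monotone_deriv f x)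
  moreover have "0 \<le> (- 1) ^ Suc n * (deriv ^^ Suc n) f x" using f x unfolding completely_monotone_def by blast
  ultimately show "\<exists>y. ((\<lambda>x. (- 1) ^ n * (deriv ^^ n) f x) has_real_derivative y) (at x) \<and> y \<le> 0"
    by (intro exI conjI) auto
qed

lemma completely_monotone_antimono:
  "completely_monotone f \<Longrightarrow> 0 < s \<Longrightarrow> s \<le> t \<Longrightarrow> f t \<le> f s"
  using completely_monotone_higher_antimono[of f s t 0] by simp

lemma completely_monotone_difference:
  assumes f: "completely_monotone f" and h: "0 < h"
  shows "completely_monotone (\<lambda>t. f t - f (t + h))"
proof -
  let ?g = "\<lambda>t. f t - f (t + h)"
  have d: "((\<lambda>t. (deriv ^^ n) f t - (deriv ^^ n) f (t + h)) has_real_derivative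
      (deriv ^^ Suc n) f t - (deriv ^^ Suc n) f (t + h)) (at t)" if "0 < t" for n t
  proof (rule DERIV_diff)
    show "((deriv ^^ n) f has_real_derivative (deriv ^^ Suc n) f t) (at t)"
      by (rule completely_monotone_deriv[OF f that])
    show "((\<lambda>t. (deriv ^^ n) f (t + h)) has_real_derivative (deriv ^^ Suc n) f (t + h)) (at t)"
      using completely_monotone_deriv[OF f, of "t + h" n] that h by (simp only: DERIV_shift)
  qed
  have e: "(deriv ^^ n) ?g t = (deriv ^^ n) f t - (deriv ^^ n) f (t + h)" if "0 < t" for n t
    using that
  proof (induction n arbitrary: t)
    case (Suc n)
    have "eventually (\<lambda>x. x \<in> {0<..}) (nhds t)"
      using Suc.prems by (intro eventually_nhds_in_open) auto
    then have "\<forall>\<^sub>F x in nhds t. (deriv ^^ n) ?g x = (deriv ^^ n) f x - (deriv ^^ n) f (x + h)"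
      by eventually_elim (use Suc.IH in auto)
    then have "deriv ((deriv ^^ n) ?g) t = deriv (\<lambda>x. (deriv ^^ n) f x - (deriv ^^ n) f (x + h)) t"
      by (rule deriv_cong_ev) simp
    also have "\<dots> = (deriv ^^ Suc n) f t - (deriv ^^ Suc n) f (t + h)"
      by (rule DERIV_imp_deriv[OF d[OF Suc.prems]])
    finally show ?case by simp
  qed simp
  show ?thesis
    unfolding completely_monotone_def
  proof (intro allI impI conjI)
    fix n and t :: real assume t: "0 < t"
    have "((deriv ^^ n) ?g has_real_derivative (deriv ^^ Suc n) f t - (deriv ^^ Suc n) f (t + h)) (at t)"
      by (rule has_field_derivative_transform_within_open[OF d[OF t], of "{0<..}"]) (use t e in auto)
    then show "(deriv ^^ n) ?g differentiable (at t)" by (auto simp: real_differentiable_def)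
    show "0 \<le> (- 1) ^ n * (deriv ^^ n) ?g t"
      using completely_monotone_higher_antimono[OF f t, of "t + h" n] h e[OF t, of n]
      by (simp add: right_diff_distrib)
  qed
qed

text \<open>
  Complete monotonicity is stable under \<open>f(t) - f(t + h)\<close>, which on the samples is \<open>nabla\<close>; the
  samples start at \<open>h\<close> since \<open>f\<close> may be unbounded at \<open>0\<close>.
\<close>

lemma cm_seq_sample:
  assumes "completely_monotone f" and h: "0 < h"
  shows "cm_seq (\<lambda>m. f (h * real (Suc m)))"
proof -
  have "0 \<le> (nabla ^^ j) (\<lambda>m. f (h * real (Suc m))) m" for j m
    using assms(1)
  proof (induction j arbitrary: f)
    case 0
    then show ?case using completely_monotone_nonneg[of f "h * real (Suc m)"] h by simp
  next
    case (Suc j)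
    have "nabla (\<lambda>m. f (h * real (Suc m))) = (\<lambda>m. f (h * real (Suc m)) - f (h * real (Suc m) + h))"
      by (auto simp: nabla_def algebra_simps)
    then have "(nabla ^^ Suc j) (\<lambda>m. f (h * real (Suc m)))
        = (nabla ^^ j) (\<lambda>m. f (h * real (Suc m)) - f (h * real (Suc m) + h))"
      by (simp add: funpow_swap1)
    then show ?case using Suc.IH[OF completely_monotone_difference[OF Suc.prems h]] by simp
  qed
  then show ?thesis by (simp add: cm_seq_def)
qed

text \<open>
  The series is the integral of a step function that converges pointwise to \<open>exp (- s t) f t\<close>.
  As \<open>f\<close> decreases and is sampled at the right end of each cell, the sample is at most \<open>f t\<close>;
  together with the bound \<open>exp (1 - s t / (s + 1))\<close> for the powers this gives an integrable
  majorant.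
\<close>

lemma sampled_laplace:
  assumes f: "completely_monotone f" and ex: "\<And>s. 0 < s \<Longrightarrow> laplace_exists f s" and s: "0 < s"
  shows "(\<lambda>N. \<Sum>m. f (real (Suc m) / real (Suc N)) / real (Suc N) * (real (Suc N) / (s + real (Suc N))) ^ m)
    \<longlonglongrightarrow> laplace f s"
proof -
  define n where "n N = real (Suc N)" for N
  define x where "x N = n N / (s + n N)" for N
  \<comment> \<open>The index of the cell \<open>(k / n, (k + 1) / n]\<close> that contains \<open>t\<close>; half-open on the left, so the
    cells cover exactly \<open>{0<..}\<close>.\<close>
  define k where "k N t = nat (\<lceil>n N * t\<rceil> - 1)" for N and t :: real
  define G where "G N m = f (real (Suc m) / n N) * x N ^ m" for N m
  have n: "0 < n N" "1 \<le> n N" for N by (auto simp: n_def)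
  have x: "0 < x N" "x N < 1" for N using n[of N] s by (auto simp: x_def)
  have cont: "isCont f t" if "0 < t" for t
    using completely_monotone_deriv[OF f that, of 0] by (simp add: DERIV_isCont)
  have kt: "real (Suc (k N t)) = of_int \<lceil>n N * t\<rceil>" if "0 < t" for N t
  proof -
    have "0 < \<lceil>n N * t\<rceil>" using that n[of N] by (simp add: zero_less_ceiling)
    then show ?thesis by (simp add: k_def)
  qed
  \<comment> \<open>A lower bound, uniform in \<open>N\<close>, for the decay rate \<open>s n / (s + n)\<close> of the powers of \<open>x\<close>.\<close>
  define s' where "s' = s / (s + 1)"
  have s': "0 < s'" using s by (simp add: s'_def)
  define w where "w t = indicat_real {0<..} t * (exp 1 * (exp (- s' * t) * f t))" for t
  define g where "g N t = indicat_real {0<..} t * G N (k N t)" for N t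
  have w: "integrable lebesgue w"
    using ex[OF s'] unfolding w_def laplace_exists_def set_integrable_def
    by (simp add: mult.left_commute)
  have bound: "norm (g N t) \<le> w t" for N t
  proof (cases "0 < t")
    case True
    have f1: "f (real (Suc (k N t)) / n N) \<le> f t"
    proof (rule completely_monotone_antimono[OF f True])
      have "n N * t \<le> real (Suc (k N t))" unfolding kt[OF True] by (rule le_of_int_ceiling)
      then show "t \<le> real (Suc (k N t)) / n N" using n[of N] by (simp add: field_simps)
    qed
    have f0: "0 \<le> f (real (Suc (k N t)) / n N)"
      by (rule completely_monotone_nonneg[OF f]) (use n in simp)
    have "ln (x N) \<le> x N - 1" by (rule ln_le_minus_one[OF x(1)])
    also have "\<dots> = - (s / (s + n N))" using s n[of N] by (simp add: x_def field_simps)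
    finally have lnx: "ln (x N) \<le> - (s / (s + n N))" .
    have "x N ^ k N t = exp (real (k N t) * ln (x N))"
      using x[of N] by (simp add: exp_of_nat_mult)
    also have "\<dots> \<le> exp (1 - s' * t)"
    proof -
      have a: "n N * t - 1 \<le> real (k N t)"
        using kt[OF True, of N] le_of_int_ceiling[of "n N * t"] by linarith
      have "real (k N t) * ln (x N) \<le> real (k N t) * (- (s / (s + n N)))"
        by (rule mult_left_mono[OF lnx]) simp
      also have "\<dots> \<le> (n N * t - 1) * (- (s / (s + n N)))"
        by (rule mult_right_mono_neg[OF a]) (use s n[of N] in simp)
      also have "\<dots> = s / (s + n N) - t * (s * (n N / (s + n N)))"
        by (simp add: algebra_simps diff_divide_distrib)
      also have "\<dots> \<le> 1 - t * (s * (1 / (s + 1)))"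
      proof (rule diff_mono)
        show "s / (s + n N) \<le> 1" using s n[of N] by simp
        have "1 / (s + 1) \<le> n N / (s + n N)" using s n[of N] by (simp add: field_simps)
        then show "t * (s * (1 / (s + 1))) \<le> t * (s * (n N / (s + n N)))"
          using s True by (intro mult_left_mono) auto
      qed
      finally show ?thesis by (simp add: s'_def mult.commute)
    qed
    finally have "x N ^ k N t \<le> exp 1 * exp (- s' * t)" by (simp add: exp_diff exp_minus divide_inverse)
    then have "f (real (Suc (k N t)) / n N) * x N ^ k N t \<le> f t * (exp 1 * exp (- s' * t))"
      using f1 f0 x[of N] completely_monotone_nonneg[OF f True] by (intro mult_mono) auto
    then show ?thesis
      using True f0 x[of N] by (simp add: g_def w_def G_def mult_ac)
  qed (simp add: g_def w_def)
  have lim: "(\<lambda>N. g N t) \<longlonglongrightarrow> indicator {0<..} t * (exp (- s * t) * f t)" for t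
  proof (cases "0 < t")
    case True
    have q: "(\<lambda>N. real (Suc (k N t)) / n N) \<longlonglongrightarrow> t"
      unfolding kt[OF True] n_def by real_asymp
    have "(\<lambda>N. (real (Suc (k N t)) / n N - 1 / n N) * (n N * ln (x N))) \<longlonglongrightarrow> (t - 0) * (- s)"
    proof (intro tendsto_mult tendsto_diff q)
      show "(\<lambda>N. 1 / n N) \<longlonglongrightarrow> 0" unfolding n_def by real_asymp
      show "(\<lambda>N. n N * ln (x N)) \<longlonglongrightarrow> - s" unfolding n_def x_def using s by real_asymp
    qed
    moreover have "(real (Suc (k N t)) / n N - 1 / n N) * (n N * ln (x N)) = real (k N t) * ln (x N)" for N
      using n[of N] by (simp add: field_simps)
    ultimately have "(\<lambda>N. real (k N t) * ln (x N)) \<longlonglongrightarrow> (t - 0) * (- s)"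
      by (simp only:)
    then have "(\<lambda>N. exp (real (k N t) * ln (x N))) \<longlonglongrightarrow> exp (- s * t)"
      by (intro tendsto_exp) (simp add: mult.commute)
    moreover have "exp (real (k N t) * ln (x N)) = x N ^ k N t" for N
      using x[of N] by (simp add: exp_of_nat_mult)
    ultimately have 1: "(\<lambda>N. x N ^ k N t) \<longlonglongrightarrow> exp (- s * t)" by simp
    have 2: "(\<lambda>N. f (real (Suc (k N t)) / n N)) \<longlonglongrightarrow> f t"
      by (rule isCont_tendsto_compose[OF cont[OF True] q])
    show ?thesis using tendsto_mult[OF 1 2] True by (simp add: g_def G_def mult.commute)
  qed (simp add: g_def)
  have km: "k N \<in> borel \<rightarrow>\<^sub>M count_space UNIV" for N
    unfolding k_def by measurable
  have gm: "g N \<in> borel_measurable lebesgue" for N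
  proof (rule measurable_completion)
    have [measurable]: "(\<lambda>t. G N (k N t)) \<in> borel_measurable borel"
      by (rule measurable_compose[OF km]) simp
    show "g N \<in> borel_measurable lborel" unfolding g_def by measurable
  qed
  have fm: "(\<lambda>t. indicat_real {0<..} t * (exp (- s * t) * f t)) \<in> borel_measurable lebesgue"
    using ex[OF s] unfolding laplace_exists_def set_integrable_def
    by (auto dest: borel_measurable_integrable)
  have gint: "integrable lebesgue (g N)" for N
    by (rule Bochner_Integration.integrable_bound[OF w gm]) (rule AE_I2, rule order_trans[OF bound], simp)
  have dom: "(\<lambda>N. integral\<^sup>L lebesgue (g N)) \<longlonglongrightarrow> (\<integral>t. indicator {0<..} t * (exp (- s * t) * f t) \<partial>lebesgue)"
    by (rule integral_dominated_convergence[OF fm gm w]) (use lim bound in auto)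
  have gsum: "integral\<^sup>L lebesgue (g N) = (\<Sum>m. G N m / n N)" for N
  proof -
    define A where "A m = {real m / n N <.. real (Suc m) / n N}" for m
    have inA: "t \<in> A m \<longleftrightarrow> 0 < t \<and> k N t = m" for t m
    proof -
      have "t \<in> A m \<longleftrightarrow> real m < n N * t \<and> n N * t \<le> real (Suc m)"
        using n[of N] by (auto simp: A_def field_simps)
      also have "\<dots> \<longleftrightarrow> \<lceil>n N * t\<rceil> = int (Suc m)"
        by (simp add: ceiling_eq_iff)
      also have "\<dots> \<longleftrightarrow> 0 < t \<and> k N t = m"
      proof
        assume c: "\<lceil>n N * t\<rceil> = int (Suc m)"
        then have "0 < \<lceil>n N * t\<rceil>" by simp
        then have "0 < n N * t" by (simp only: zero_less_ceiling)
        then show "0 < t \<and> k N t = m" using c n[of N] by (simp add: k_def zero_less_mult_iff)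
      next
        assume "0 < t \<and> k N t = m"
        then have "real (Suc m) = of_int \<lceil>n N * t\<rceil>" using kt[of t N] by simp
        then show "\<lceil>n N * t\<rceil> = int (Suc m)" by linarith
      qed
      finally show ?thesis .
    qed
    have UA: "(\<Union>m. A m) = {0<..}" using inA by auto
    have disj: "A i \<inter> A j = {}" if "i \<noteq> j" for i j using inA that by auto
    have "integral\<^sup>L lebesgue (g N) = (LINT t:(\<Union>m. A m)|lebesgue. G N (k N t))"
      unfolding UA set_lebesgue_integral_def g_def by simp
    also have "\<dots> = (\<Sum>m. LINT t:A m|lebesgue. G N (k N t))"
    proof (rule lebesgue_integral_countable_add[OF _ disj])
      show "set_integrable lebesgue (\<Union>m. A m) (\<lambda>t. G N (k N t))"
        using gint[of N] unfolding UA set_integrable_def g_def by simp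
    qed (auto simp: A_def)
    also have "(\<lambda>m. LINT t:A m|lebesgue. G N (k N t)) = (\<lambda>m. G N m / n N)"
    proof
      fix m
      have "(LINT t:A m|lebesgue. G N (k N t)) = (LINT t:A m|lebesgue. G N m)"
        by (rule set_lebesgue_integral_cong) (use inA in \<open>auto simp: A_def\<close>)
      also have "\<dots> = measure lebesgue (A m) * G N m"
        unfolding set_lebesgue_integral_def by simp
      also have "measure lebesgue (A m) = 1 / n N"
        using n[of N] by (simp add: A_def divide_right_mono field_simps)
      finally show "(LINT t:A m|lebesgue. G N (k N t)) = G N m / n N" by simp
    qed
    finally show ?thesis .
  qed
  show ?thesis
    using dom unfolding gsum laplace_def set_lebesgue_integral_def
    by (simp add: G_def x_def n_def)
qed

section \<open>Uniqueness of the Laplace transform\<close>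

text \<open>
  Lerch's argument. In the variable \<open>x = exp (- t)\<close> the vanishing of the transform at the
  positive integers says that \<open>exp (- t) h t\<close> is orthogonal to all polynomials in \<open>x\<close>, hence by
  Weierstrass to a tent \<open>\<phi>\<close> around \<open>exp (- t0)\<close>. If \<open>h t0 > 0\<close>, a narrow tent sees only positive
  values of \<open>h\<close>, which is absurd.
\<close>

lemma laplace_zero_imp_nonpos:
  assumes cont: "continuous_on {0<..} h" and ex: "\<And>s. 0 < s \<Longrightarrow> laplace_exists h s"
    and zero: "\<And>s. 0 < s \<Longrightarrow> laplace h s = 0" and t0: "0 < t0"
  shows "h t0 \<le> 0"
proof (rule ccontr)
  assume "\<not> h t0 \<le> 0"
  then have pos: "0 < h t0" by simp
  define w where "w t = indicator {0<..} t * (exp (- t) * h t)" for t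
  have wpow: "integrable lebesgue (\<lambda>t. exp (- t) ^ i * w t)" "(\<integral>t. exp (- t) ^ i * w t \<partial>lebesgue) = 0" for i
  proof -
    have eq: "indicator {0<..} t *\<^sub>R (exp (- (real i + 1) * t) * h t) = exp (- t) ^ i * w t" for t
      by (simp add: w_def exp_of_nat_mult[symmetric] mult_exp_exp algebra_simps)
    show "integrable lebesgue (\<lambda>t. exp (- t) ^ i * w t)"
      using ex[of "real i + 1"] unfolding laplace_exists_def set_integrable_def eq by simp
    show "(\<integral>t. exp (- t) ^ i * w t \<partial>lebesgue) = 0"
      using zero[of "real i + 1"] unfolding laplace_def set_lebesgue_integral_def eq by simp
  qed
  have w: "integrable lebesgue w" using wpow(1)[of 0] by simp
  have poly: "integrable lebesgue (\<lambda>t. q (exp (- t)) * w t) \<and> (\<integral>t. q (exp (- t)) * w t \<partial>lebesgue) = 0"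
    if q: "polynomial_function q" for q :: "real \<Rightarrow> real"
  proof -
    obtain a n where "q = (\<lambda>x. \<Sum>i\<le>n. a i * x ^ i)"
      using q by (auto simp: real_polynomial_function_eq[symmetric] real_polynomial_function_iff_sum)
    then have "(\<lambda>t. q (exp (- t)) * w t) = (\<lambda>t. \<Sum>i\<le>n. a i * (exp (- t) ^ i * w t))"
      by (simp add: sum_distrib_right mult.assoc)
    then show ?thesis using wpow by (simp add: Bochner_Integration.integral_sum)
  qed
  define x0 where "x0 = exp (- t0)"
  have "isCont h t0" using cont t0 by (simp add: continuous_on_eq_continuous_at)
  then have "\<forall>\<^sub>F t in at t0. 0 < h t" using pos by (auto simp: isCont_def dest: order_tendstoD)
  then have "\<forall>\<^sub>F t in nhds t0. 0 < h t" using pos by (simp add: eventually_nhds_conv_at)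
  moreover have "(\<lambda>x. - ln x) \<midarrow>x0\<rightarrow> t0"
  proof -
    have "isCont (\<lambda>x. - ln x) x0" by (intro continuous_intros) (simp add: x0_def)
    then show ?thesis by (simp add: isCont_def x0_def)
  qed
  ultimately have "\<forall>\<^sub>F x in at x0. 0 < h (- ln x)" by (auto simp: filterlim_iff)
  then obtain \<eta> where \<eta>: "0 < \<eta>" and near: "\<And>x. x \<noteq> x0 \<Longrightarrow> \<bar>x - x0\<bar> < \<eta> \<Longrightarrow> 0 < h (- ln x)"
    by (auto simp: eventually_at dist_real_def)
  have hpos: "0 < h t" if "\<bar>exp (- t) - x0\<bar> < \<eta>" for t
    using near[of "exp (- t)"] that pos by (cases "t = t0") (auto simp: x0_def)
  define \<phi> where "\<phi> x = max 0 (\<eta> - \<bar>x - x0\<bar>)" for x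
  have \<phi>cont: "continuous_on S \<phi>" for S unfolding \<phi>_def by (intro continuous_intros)
  have \<phi>w_nonneg: "0 \<le> \<phi> (exp (- t)) * w t" for t
    using hpos[of t] by (cases "\<bar>exp (- t) - x0\<bar> < \<eta>") (auto simp: \<phi>_def w_def)
  have \<phi>w: "integrable lebesgue (\<lambda>t. \<phi> (exp (- t)) * w t)"
  proof (rule Bochner_Integration.integrable_bound[of _ "\<lambda>t. \<eta> * w t"])
    have "(\<lambda>t. \<phi> (exp (- t))) \<in> borel_measurable lebesgue"
      unfolding \<phi>_def by (rule measurable_completion) measurable
    then show "(\<lambda>t. \<phi> (exp (- t)) * w t) \<in> borel_measurable lebesgue"
      by (rule borel_measurable_times) (rule borel_measurable_integrable[OF w])
    show "AE t in lebesgue. norm (\<phi> (exp (- t)) * w t) \<le> norm (\<eta> * w t)"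
      using \<eta> by (intro AE_I2) (auto simp: abs_mult \<phi>_def intro!: mult_right_mono)
  qed (use w in simp)
  have "\<bar>\<integral>t. \<phi> (exp (- t)) * w t \<partial>lebesgue\<bar> \<le> 0 + e" if "0 < e" for e
  proof -
    \<comment> \<open>The summand \<open>1\<close> keeps \<open>B\<close> positive when \<open>w\<close> vanishes almost everywhere.\<close>
    define B where "B = (\<integral>t. \<bar>w t\<bar> \<partial>lebesgue) + 1"
    have B: "0 < B" unfolding B_def by (intro add_nonneg_pos integral_nonneg) auto
    obtain q where q: "polynomial_function q" and qe: "\<And>x. x \<in> {0..1} \<Longrightarrow> norm (\<phi> x - q x) < e / B"
      using Stone_Weierstrass_polynomial_function[of "{0..1::real}" \<phi> "e / B"] \<phi>cont \<open>0 < e\<close> B by auto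
    have "(\<integral>t. \<phi> (exp (- t)) * w t \<partial>lebesgue) = (\<integral>t. (\<phi> (exp (- t)) * w t - q (exp (- t)) * w t) \<partial>lebesgue)"
      using \<phi>w poly[OF q] by simp
    also have "\<bar>\<dots>\<bar> \<le> (\<integral>t. e / B * \<bar>w t\<bar> \<partial>lebesgue)"
      unfolding real_norm_def[symmetric]
    proof (rule Bochner_Integration.integral_norm_bound_integral)
      fix t
      show "norm (\<phi> (exp (- t)) * w t - q (exp (- t)) * w t) \<le> e / B * norm (w t)"
      proof (cases "0 < t")
        case True
        then have "norm (\<phi> (exp (- t)) - q (exp (- t))) \<le> e / B" by (intro less_imp_le qe) auto
        then show ?thesis
          by (simp only: left_diff_distrib[symmetric] norm_mult) (rule mult_right_mono, auto)
      qed (simp add: w_def)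
    qed (use \<phi>w poly[OF q] w in auto)
    also have "\<dots> = e / B * (B - 1)" by (simp add: B_def)
    also have "\<dots> \<le> e" using B \<open>0 < e\<close> by (simp add: field_simps)
    finally show ?thesis by simp
  qed
  then have "(\<integral>t. \<phi> (exp (- t)) * w t \<partial>lebesgue) = 0" using field_le_epsilon[of "\<bar>\<integral>t. \<phi> (exp (- t)) * w t \<partial>lebesgue\<bar>" 0] by simp
  then have ae: "AE t in lebesgue. \<phi> (exp (- t)) * w t = 0"
    using integral_nonneg_eq_0_iff_AE[OF \<phi>w] \<phi>w_nonneg by simp
  define near_t0 where "near_t0 = {t::real. 0 < t \<and> \<bar>exp (- t) - x0\<bar> < \<eta>}"
  have "open near_t0" unfolding near_t0_def by (intro open_Collect_conj open_Collect_less continuous_intros)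
  moreover have "t0 \<in> near_t0" using t0 \<eta> by (simp add: near_t0_def x0_def)
  moreover have "negligible near_t0"
  proof -
    have "AE t in lebesgue. t \<notin> near_t0"
      using ae by eventually_elim (use hpos in \<open>fastforce simp: near_t0_def \<phi>_def w_def\<close>)
    moreover have "near_t0 \<in> sets lebesgue" using \<open>open near_t0\<close> by auto
    ultimately have "near_t0 \<in> null_sets lebesgue" by (simp add: AE_iff_null_sets)
    then show ?thesis by (simp add: negligible_iff_null_sets)
  qed
  ultimately show False using open_not_negligible by auto
qed

lemma laplace_unique:
  assumes f: "continuous_on {0<..} f" "\<And>s. 0 < s \<Longrightarrow> laplace_exists f s"
    and g: "continuous_on {0<..} g" "\<And>s. 0 < s \<Longrightarrow> laplace_exists g s"
    and eq: "\<And>s. 0 < s \<Longrightarrow> laplace f s = laplace g s" and t: "0 < t"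
  shows "f t = g t"
proof -
  have "a t - b t \<le> 0"
    if a: "continuous_on {0<..} a" "\<And>s. 0 < s \<Longrightarrow> laplace_exists a s"
    and b: "continuous_on {0<..} b" "\<And>s. 0 < s \<Longrightarrow> laplace_exists b s"
    and eq: "\<And>s. 0 < s \<Longrightarrow> laplace a s = laplace b s" for a b
  proof (rule laplace_zero_imp_nonpos[OF _ _ _ t])
    show "continuous_on {0<..} (\<lambda>t. a t - b t)" using a b by (intro continuous_intros)
    fix s :: real assume s: "0 < s"
    show "laplace_exists (\<lambda>t. a t - b t) s"
      using set_integral_diff(1)[OF a(2)[OF s, unfolded laplace_exists_def] b(2)[OF s, unfolded laplace_exists_def]]
      by (simp add: laplace_exists_def right_diff_distrib)
    show "laplace (\<lambda>t. a t - b t) s = 0"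
      using set_integral_diff(2)[OF a(2)[OF s, unfolded laplace_exists_def] b(2)[OF s, unfolded laplace_exists_def]] eq[OF s]
      by (simp add: laplace_def right_diff_distrib)
  qed
  from this[of f g] this[of g f] f g eq show ?thesis by force
qed

section \<open>The discretised relaxation equation\<close>

lemma nabla_funpow_scale: "(nabla ^^ j) (\<lambda>m. r * b m) = (\<lambda>m. r * (nabla ^^ j) b m)"
  by (induction j) (auto simp: nabla_def algebra_simps)

lemma cm_seq_scale: "cm_seq b \<Longrightarrow> 0 \<le> r \<Longrightarrow> cm_seq (\<lambda>m. r * b m)"
  by (simp add: cm_seq_def nabla_funpow_scale)

lemma szasz_real_scale:
  assumes "cm_seq b"
  shows "szasz_real n (\<lambda>m. r * b m) t = r * szasz_real n b t"
proof -
  have "(\<Sum>m. r * (b m / fact m * (n * t) ^ m)) = r * (\<Sum>m. b m / fact m * (n * t) ^ m)"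
    by (rule suminf_mult[OF summable_expgen[OF assms]])
  then show ?thesis by (simp add: szasz_real_def algebra_simps)
qed

lemma conv_radius_cm_seq:
  fixes A :: "real fps"
  assumes "cm_seq (($) A)"
  shows "1 \<le> fps_conv_radius A"
  unfolding fps_conv_radius_def
proof (rule conv_radius_geI_ex')
  fix r :: real assume r: "0 < r" "ereal r < 1"
  then have "r < 1" by simp
  show "summable (\<lambda>m. A $ m * of_real r ^ m)"
  proof (rule summable_comparison_test[OF _ summable_mult[OF summable_geometric, of r "A $ 0"]])
    show "\<exists>N. \<forall>m\<ge>N. norm (A $ m * of_real r ^ m) \<le> A $ 0 * r ^ m"
      using cm_seq_nonneg[OF assms] cm_seq_le_0[OF assms] r by (auto simp: abs_mult power_abs intro!: mult_right_mono)
  qed (use r \<open>r < 1\<close> in simp)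
qed

text \<open>
  Coefficients of completely monotone sequences are bounded, so all series converge in the unit
  disc and the formal identity can be evaluated.
\<close>

lemma eval_resolvent:
  fixes A :: "real fps"
  assumes n: "0 < n" and l: "0 < l" and A: "cm_seq (($) A)" and x: "0 \<le> x" "x < 1"
  shows "eval_fps (A * resolvent n l A) x = eval_fps A x / (n * (1 - x) * eval_fps A x + l)"
proof -
  let ?V = "resolvent n l A" and ?U = "A * resolvent n l A"
  let ?B = "fps_const n * (1 - fps_X) * A"
  have A0: "0 \<le> A $ 0" by (rule cm_seq_nonneg[OF A])
  have xr: "ereal (norm x) < 1" using x by simp
  have rA: "ereal (norm x) < fps_conv_radius A" using xr conv_radius_cm_seq[OF A] by (rule less_le_trans)
  have rU: "ereal (norm x) < fps_conv_radius ?U"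
    using xr conv_radius_cm_seq[OF cm_seq_resolvent[OF n l A0 A]] by (rule less_le_trans)
  have r1: "ereal (norm x) < fps_conv_radius (1 - fps_X :: real fps)"
    using fps_conv_radius_diff[of "1 :: real fps" fps_X] by simp
  have rc: "ereal (norm x) < fps_conv_radius (fps_const n * (1 - fps_X))"
    by (rule less_le_trans[OF _ fps_conv_radius_mult]) (use r1 in \<open>simp add: min_less_iff_conj\<close>)
  have rB: "ereal (norm x) < fps_conv_radius ?B"
    by (rule less_le_trans[OF _ fps_conv_radius_mult]) (simp only: min_less_iff_conj rc rA)
  have rBl: "ereal (norm x) < fps_conv_radius (?B + fps_const l)"
    by (rule less_le_trans[OF _ fps_conv_radius_add]) (use rB in \<open>simp add: min_less_iff_conj\<close>)
  have eB: "eval_fps (?B + fps_const l) x = n * (1 - x) * eval_fps A x + l"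
    using rB rA rc r1 by (simp add: eval_fps_add eval_fps_mult eval_fps_diff)
  have "?U * (?B + fps_const l) = A * (?V * (?B + fps_const l))" by (rule mult.assoc)
  also have "\<dots> = A" by (simp only: resolvent_mult[OF n l A0] mult_1_right)
  finally have UA: "?U * (?B + fps_const l) = A" .
  have "eval_fps ?U x * (n * (1 - x) * eval_fps A x + l) = eval_fps A x"
    using eval_fps_mult[OF rU rBl] by (simp only: UA eB)
  moreover have "0 \<le> eval_fps A x"
    unfolding eval_fps_def using x cm_seq_nonneg[OF A] by (intro suminf_nonneg summable_fps rA) auto
  then have "0 < n * (1 - x) * eval_fps A x + l" using n l x by (intro add_nonneg_pos) auto
  ultimately show ?thesis by (simp add: field_simps)
qed

text \<open>
  The samples are weighted by the mesh, so that the series approximates the Laplace integral.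
\<close>

definition sampled :: "(real \<Rightarrow> real) \<Rightarrow> nat \<Rightarrow> real fps" where
  "sampled f N = Abs_fps (\<lambda>m. f (real (Suc m) / real (Suc N)) / real (Suc N))"

text \<open>
  The factor \<open>n\<close> makes this the sequence of values of the discrete fundamental solution, started
  at no more than \<open>1\<close>.
\<close>

definition approx_seq :: "(real \<Rightarrow> real) \<Rightarrow> real \<Rightarrow> nat \<Rightarrow> nat \<Rightarrow> real" where
  "approx_seq f l N m = real (Suc N) * (sampled f N * resolvent (real (Suc N)) l (sampled f N)) $ m"

context
  fixes f :: "real \<Rightarrow> real"
  assumes f: "completely_monotone f"
begin

lemma cm_seq_sampled: "cm_seq (($) (sampled f N))"
proof -
  have "cm_seq (\<lambda>m. (1 / real (Suc N)) * f ((1 / real (Suc N)) * real (Suc m)))"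
    by (intro cm_seq_scale cm_seq_sample f) auto
  moreover have "(($) (sampled f N)) = (\<lambda>m. (1 / real (Suc N)) * f ((1 / real (Suc N)) * real (Suc m)))"
    by (auto simp: sampled_def)
  ultimately show ?thesis by simp
qed

lemma cm_seq_approx: "0 < l \<Longrightarrow> cm_seq (approx_seq f l N)"
  unfolding approx_seq_def[abs_def]
  by (intro cm_seq_scale cm_seq_resolvent cm_seq_sampled cm_seq_nonneg[OF cm_seq_sampled]) auto

lemma approx_seq_le_1:
  assumes "0 < l"
  shows "approx_seq f l N 0 \<le> 1"
proof -
  let ?A = "sampled f N" and ?n = "real (Suc N)"
  have "approx_seq f l N 0 + l * resolvent ?n l ?A $ 0 = 1"
    unfolding approx_seq_def
    by (rule resolvent_balance_nth(1)) (use assms cm_seq_nonneg[OF cm_seq_sampled] in auto)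
  moreover have "0 \<le> l * resolvent ?n l ?A $ 0"
    using assms resolvent_nonneg[of ?n l ?A 0] cm_seq_sampled cm_seq_nonneg[OF cm_seq_sampled] by simp
  ultimately show ?thesis by linarith
qed

text \<open>
  The scaled differences in the second claim are, by the balance of coefficients, the
  coefficients of the resolvent.
\<close>

lemma approx_seq_antitone:
  assumes "0 < l1" "l1 \<le> l"
  shows "approx_seq f l N m \<le> approx_seq f l1 N m"
    and "nabla (approx_seq f l N) m / l \<le> nabla (approx_seq f l1 N) m / l1"
proof -
  let ?A = "sampled f N" and ?n = "real (Suc N)"
  have n: "0 < ?n" by simp
  show "approx_seq f l N m \<le> approx_seq f l1 N m"
    unfolding approx_seq_def
    by (intro mult_left_mono resolvent_antitone(2) n assms cm_seq_sampled) simp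
  have nab: "nabla (approx_seq f k N) m / k = resolvent ?n k ?A $ Suc m" if k: "0 < k" for k
    using resolvent_balance_nth(2)[OF n k cm_seq_nonneg[OF cm_seq_sampled[of N]], of m] k
    by (simp add: approx_seq_def nabla_def field_simps)
  show "nabla (approx_seq f l N) m / l \<le> nabla (approx_seq f l1 N) m / l1"
    using assms resolvent_antitone(1)[OF n assms cm_seq_sampled] by (simp add: nab)
qed

text \<open>
  At \<open>x = n / (s + n)\<close> one has \<open>n (1 - x) = s x\<close>, so the transform is exactly
  \<open>x S / (s x S + l)\<close> with \<open>S\<close> the sampled transform at \<open>x\<close>; and \<open>x \<longlonglongrightarrow> 1\<close>.
\<close>

lemma laplace_approx:
  assumes ex: "\<And>s. 0 < s \<Longrightarrow> laplace_exists f s" and l: "0 < l" and s: "0 < s"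
  shows "(\<lambda>N. laplace (szasz_real (real (Suc N)) (approx_seq f l N)) s)
    \<longlonglongrightarrow> laplace f s / (s * laplace f s + l)"
proof -
  define n where "n N = real (Suc N)" for N
  define x where "x N = n N / (s + n N)" for N
  define S where "S N = eval_fps (sampled f N) (x N)" for N
  have n: "0 < n N" for N by (simp add: n_def)
  have x: "0 \<le> x N" "x N < 1" for N using n[of N] s by (auto simp: x_def)
  have eq: "laplace (szasz_real (n N) (approx_seq f l N)) s = x N * (S N / (s * x N * S N + l))" for N
  proof -
    have "(\<lambda>m. approx_seq f l N m * x N ^ m) sums ((s + n N) * laplace (szasz_real (n N) (approx_seq f l N)) s)"
      unfolding x_def by (rule laplace_szasz(2)[OF cm_seq_approx[OF l] n s])
    moreover have "(\<lambda>m. approx_seq f l N m * x N ^ m) sums (n N * eval_fps (sampled f N * resolvent (n N) l (sampled f N)) (x N))"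
    proof -
      have "ereal (norm (x N)) < 1" using x by simp
      also have "1 \<le> fps_conv_radius (sampled f N * resolvent (n N) l (sampled f N))"
        by (intro conv_radius_cm_seq cm_seq_resolvent cm_seq_sampled n l cm_seq_nonneg[OF cm_seq_sampled])
      finally have "summable (\<lambda>m. (sampled f N * resolvent (n N) l (sampled f N)) $ m * x N ^ m)"
        by (rule summable_fps)
      then have "(\<lambda>m. n N * ((sampled f N * resolvent (n N) l (sampled f N)) $ m * x N ^ m)) sums
          (n N * eval_fps (sampled f N * resolvent (n N) l (sampled f N)) (x N))"
        unfolding eval_fps_def by (intro sums_mult summable_sums)
      then show ?thesis by (simp add: approx_seq_def n_def mult.assoc)
    qed
    ultimately have "(s + n N) * laplace (szasz_real (n N) (approx_seq f l N)) s
        = n N * (S N / (n N * (1 - x N) * S N + l))"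
      unfolding S_def eval_resolvent[OF n l cm_seq_sampled x, symmetric] by (rule sums_unique2)
    moreover have "n N * (1 - x N) = s * x N" using n[of N] s by (simp add: x_def field_simps)
    ultimately have "(s + n N) * laplace (szasz_real (n N) (approx_seq f l N)) s
        = n N * (S N / (s * x N * S N + l))" by (simp only:)
    moreover have "0 < s + n N" using n[of N] s by simp
    ultimately have "laplace (szasz_real (n N) (approx_seq f l N)) s = n N * (S N / (s * x N * S N + l)) / (s + n N)"
      by (metis nonzero_mult_div_cancel_left less_irrefl)
    then show ?thesis by (simp add: x_def)
  qed
  have S: "S \<longlonglongrightarrow> laplace f s"
    using sampled_laplace[OF f ex s] unfolding S_def eval_fps_def by (simp add: sampled_def x_def n_def)
  have S0: "0 \<le> S N" for N
  proof -
    have "ereal (norm (x N)) < 1" using x by simp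
    also note conv_radius_cm_seq[OF cm_seq_sampled[of N]]
    finally show ?thesis unfolding S_def eval_fps_def
      using x cm_seq_nonneg[OF cm_seq_sampled] by (intro suminf_nonneg summable_fps) auto
  qed
  have "0 \<le> laplace f s" by (rule LIMSEQ_le_const[OF S]) (use S0 in auto)
  then have "0 < s * 1 * laplace f s + l" using s l by (simp add: add_nonneg_pos)
  then have "(\<lambda>N. x N * (S N / (s * x N * S N + l))) \<longlonglongrightarrow> 1 * (laplace f s / (s * 1 * laplace f s + l))"
  proof (intro tendsto_intros S)
    show "x \<longlonglongrightarrow> 1" unfolding x_def n_def by real_asymp
    then show "x \<longlonglongrightarrow> 1" .
  qed simp
  then show ?thesis unfolding n_def[symmetric] eq by simp
qed

end

section \<open>Consequences of complete monotonicity and of the transform\<close>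

abbreviation right_halfplane :: "complex set" where
  "right_halfplane \<equiv> {z. 0 < Re z}"

lemma right_halfplane_facts: "open right_halfplane" "connected right_halfplane"
  by (simp_all add: open_halfspace_Re_gt convex_halfspace_Re_gt convex_connected)

text \<open>
  Links the complex derivative to the real one used in the definition of complete monotonicity.
\<close>

lemma holomorphic_real_deriv:
  assumes F: "F holomorphic_on right_halfplane" and eq: "\<And>t. 0 < t \<Longrightarrow> F (of_real t) = of_real (f t)"
    and t: "0 < t"
  shows "(f has_real_derivative Re (deriv F (of_real t))) (at t)"
    and "deriv F (of_real t) = of_real (Re (deriv F (of_real t)))"
proof -
  let ?D = "deriv F (of_real t)"
  have "(F has_field_derivative ?D) (at (of_real t))"
    using holomorphic_derivI[OF F right_halfplane_facts(1)] t by simp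
  then have "((\<lambda>x. F (of_real x)) has_vector_derivative ?D) (at t)"
    by (rule has_vector_derivative_real_field)
  then have v: "((\<lambda>x. complex_of_real (f x)) has_vector_derivative ?D) (at t)"
    by (rule has_vector_derivative_transform_within_open[of _ _ _ "{0<..}"]) (use t eq in auto)
  show "(f has_real_derivative Re ?D) (at t)"
    using bounded_linear.has_vector_derivative[OF bounded_linear_Re v]
    by (simp add: has_real_derivative_iff_has_vector_derivative)
  have "((\<lambda>x. 0) has_vector_derivative Im ?D) (at t)"
    using bounded_linear.has_vector_derivative[OF bounded_linear_Im v] by simp
  then have "Im ?D = 0"
    using vector_derivative_unique_at[OF _ has_vector_derivative_const] by blast
  then show "?D = of_real (Re ?D)" by (simp add: complex_eq_iff)
qed

lemma holomorphic_real_higher_deriv: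
  assumes F: "F holomorphic_on right_halfplane" and eq: "\<And>t. 0 < t \<Longrightarrow> F (of_real t) = of_real (f t)"
    and t: "0 < t"
  shows "(deriv ^^ n) F (of_real t) = of_real ((deriv ^^ n) f t)"
    and "((deriv ^^ n) f has_real_derivative (deriv ^^ Suc n) f t) (at t)"
proof -
  have hol: "(deriv ^^ n) F holomorphic_on right_halfplane" for n
    by (rule holomorphic_higher_deriv[OF F right_halfplane_facts(1)])
  have A: "\<forall>t>0. (deriv ^^ n) F (of_real t) = of_real ((deriv ^^ n) f t)" for n
  proof (induction n)
    case (Suc n)
    show ?case
    proof (intro allI impI)
      fix t :: real assume t: "0 < t"
      note d = holomorphic_real_deriv[OF hol, of n "(deriv ^^ n) f" t]
      have "deriv ((deriv ^^ n) f) t = Re (deriv ((deriv ^^ n) F) (of_real t))"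
        by (rule DERIV_imp_deriv, rule d(1)) (use Suc.IH t in auto)
      moreover have "deriv ((deriv ^^ n) F) (of_real t) = of_real (Re (deriv ((deriv ^^ n) F) (of_real t)))"
        by (rule d(2)) (use Suc.IH t in auto)
      ultimately show "(deriv ^^ Suc n) F (of_real t) = of_real ((deriv ^^ Suc n) f t)" by simp
    qed
  qed (use eq in simp)
  show "(deriv ^^ n) F (of_real t) = of_real ((deriv ^^ n) f t)" using A t by blast
  have "((deriv ^^ n) f has_real_derivative Re (deriv ((deriv ^^ n) F) (of_real t))) (at t)"
    by (rule holomorphic_real_deriv(1)[OF hol]) (use A t in auto)
  moreover have "deriv ((deriv ^^ n) F) (of_real t) = of_real ((deriv ^^ Suc n) f t)"
    using A[of "Suc n"] t by simp
  ultimately show "((deriv ^^ n) f has_real_derivative (deriv ^^ Suc n) f t) (at t)" by simp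
qed

text \<open>
  Being nonnegative and decreasing, \<open>f\<close> vanishes beyond \<open>t0\<close>; the identity theorem does the
  rest.
\<close>

lemma completely_monotone_zero:
  assumes F: "F holomorphic_on right_halfplane" and eq: "\<And>t. 0 < t \<Longrightarrow> F (of_real t) = of_real (f t)"
    and f: "completely_monotone f" and t0: "0 < t0" "f t0 = 0" and t: "0 < t"
  shows "f t = 0"
proof -
  have z: "f x = 0" if "t0 \<le> x" for x
    using completely_monotone_antimono[OF f t0(1) that] completely_monotone_nonneg[OF f, of x] t0 that by simp
  \<comment> \<open>At \<open>t0 + 1\<close> the function vanishes on both sides, so all derivatives do.\<close>
  have "(deriv ^^ n) F (of_real (t0 + 1)) = 0" for n
  proof -
    have "eventually (\<lambda>x. x \<in> {t0<..}) (nhds (t0 + 1))"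
      by (intro eventually_nhds_in_open) auto
    then have "\<forall>\<^sub>F x in nhds (t0 + 1). f x = (\<lambda>_. 0) x"
      by eventually_elim (use z in auto)
    then have "(deriv ^^ n) f (t0 + 1) = (deriv ^^ n) (\<lambda>_. 0) (t0 + 1)"
      by (rule higher_deriv_cong_ev) simp
    also have "(deriv ^^ n) (\<lambda>_. 0 :: real) = (\<lambda>_. 0)" by (induction n) auto
    finally have "(deriv ^^ n) f (t0 + 1) = 0" .
    then show ?thesis
      using holomorphic_real_higher_deriv(1)[OF F, of f "t0 + 1" n] eq t0 by simp
  qed
  then have "F (of_real t) = 0"
    using holomorphic_fun_eq_0_on_connected[OF F right_halfplane_facts, of "of_real (t0 + 1)" "of_real t"] t0 t
    by simp
  then show ?thesis using eq[OF t] by simp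
qed

lemma laplace_exp_int:
  assumes "0 < s"
  shows "set_integrable lebesgue {0<..} (\<lambda>t::real. exp (- s * t))"
    and "(LINT t:{0<..}|lebesgue. exp (- s * t)) = 1 / s"
  using laplace_power[OF assms, of 0]
  by (simp_all add: set_integrable_def set_lebesgue_integral_def has_bochner_integral_iff)

lemma laplace_nonneg: "(\<And>t. 0 < t \<Longrightarrow> 0 \<le> f t) \<Longrightarrow> 0 \<le> laplace f s"
  unfolding laplace_def set_lebesgue_integral_def
  by (rule Bochner_Integration.integral_nonneg) (simp add: indicator_def)

lemma FTC_nonneg_lebesgue:
  fixes F f :: "real \<Rightarrow> real"
  assumes T: "0 < T"
    and F: "\<And>t. 0 < t \<Longrightarrow> ereal t < T \<Longrightarrow> (F has_real_derivative f t) (at t)"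
    and cont: "\<And>t. 0 < t \<Longrightarrow> ereal t < T \<Longrightarrow> isCont f t"
    and nonneg: "\<And>t. 0 < t \<Longrightarrow> ereal t < T \<Longrightarrow> 0 \<le> f t"
    and A: "(F \<longlongrightarrow> A) (at_right 0)" and B: "((F \<circ> real_of_ereal) \<longlongrightarrow> B) (at_left T)"
  shows "set_integrable lebesgue (einterval 0 T) f" "(LINT t:einterval 0 T|lebesgue. f t) = B - A"
proof -
  have A': "((F \<circ> real_of_ereal) \<longlongrightarrow> A) (at_right 0)"
    using A by (simp add: zero_ereal_def ereal_tendsto_simps1)
  have 1: "set_integrable lborel (einterval 0 T) f" and 2: "(LBINT t=0..T. f t) = B - A"
    by (rule interval_integral_FTC_nonneg[OF T _ _ _ A' B]; use F cont nonneg in \<open>auto simp: zero_ereal_def\<close>)+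
  have m: "(\<lambda>t. indicator (einterval 0 T) t *\<^sub>R f t) \<in> borel_measurable lborel"
    using 1 unfolding set_integrable_def by (rule borel_measurable_integrable)
  show "set_integrable lebesgue (einterval 0 T) f"
    using 1 m unfolding set_integrable_def by (simp add: integrable_completion)
  show "(LINT t:einterval 0 T|lebesgue. f t) = B - A"
  proof -
    have "(LBINT t:einterval 0 T. f t) = B - A"
      using 2 less_imp_le[OF T] by (simp add: interval_lebesgue_integral_def)
    then show ?thesis
      unfolding set_lebesgue_integral_def integral_completion[OF m] .
  qed
qed

text \<open>
  A completely monotone \<open>u\<close> with values in \<open>[0, 1]\<close>, with holomorphic continuation \<open>g\<close>, whose
  transform is that of the fundamental solution for a kernel with transform \<open>K\<close>. These data
  alone determine everything claimed about one value of \<open>l\<close>.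
\<close>

locale relaxation_data =
  fixes u v K :: "real \<Rightarrow> real" and l :: real and g :: "complex \<Rightarrow> complex"
  assumes l: "0 < l" and K: "\<And>s. 0 < s \<Longrightarrow> 0 \<le> K s" and Kinf: "filterlim (\<lambda>s. s * K s) at_top at_top"
    and g: "g holomorphic_on right_halfplane" and gu: "\<And>t. 0 < t \<Longrightarrow> g (of_real t) = of_real (u t)"
    and ucm: "completely_monotone u" and u1: "\<And>t. 0 < t \<Longrightarrow> u t \<le> 1"
    and uex: "\<And>s. 0 < s \<Longrightarrow> laplace_exists u s"
    and ulap: "\<And>s. 0 < s \<Longrightarrow> laplace u s = K s / (s * K s + l)"
    and v_def: "v = (\<lambda>t. - deriv u t / l)"
begin

lemma denom_pos: "0 < s \<Longrightarrow> 0 < s * K s + l"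
  using K[of s] l by (simp add: add_nonneg_pos)

text \<open>
  If \<open>u\<close> stayed below some \<open>e < 1\<close>, then \<open>s u^(s) \<le> e\<close> for all \<open>s\<close>, whereas
  \<open>s u^(s) = G / (G + l)\<close> with \<open>G = s K s\<close> unbounded.
\<close>

lemma u_at_0: "(u \<longlongrightarrow> 1) (at_right 0)"
proof (rule order_tendstoI)
  fix e :: real assume "1 < e"
  then show "\<forall>\<^sub>F t in at_right 0. u t < e"
    by (intro eventually_at_rightI[of 0 1] le_less_trans[OF u1]) auto
next
  fix e :: real assume e: "e < 1"
  have "\<exists>t1>0. e < u t1"
  proof (rule ccontr)
    assume "\<not> ?thesis"
    then have ue: "u t \<le> e" if "0 < t" for t using that by force
    have "\<forall>\<^sub>F s in at_top. s * K s > l / (1 - e)" using Kinf by (simp add: filterlim_at_top_dense)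
    moreover have "\<forall>\<^sub>F s::real in at_top. 0 < s" by (rule eventually_gt_at_top)
    ultimately have "\<forall>\<^sub>F s in at_top. s * K s > l / (1 - e) \<and> 0 < s" by eventually_elim simp
    then obtain s where s: "l / (1 - e) < s * K s" "0 < s" by (auto dest: eventually_happens)
    have "laplace u s \<le> (LINT t:{0<..}|lebesgue. e * exp (- s * t))"
      unfolding laplace_def
    proof (rule set_integral_mono)
      show "set_integrable lebesgue {0<..} (\<lambda>t. exp (- s * t) * u t)"
        using uex[OF s(2)] by (simp add: laplace_exists_def)
      show "set_integrable lebesgue {0<..} (\<lambda>t. e * exp (- s * t))"
        using laplace_exp_int(1)[OF s(2)] by (rule set_integrable_mult_right)
    qed (use ue in \<open>simp add: mult.commute\<close>)
    also have "\<dots> = e / s" using laplace_exp_int(2)[OF s(2)] by simp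
    finally have "s * laplace u s \<le> e" using s(2) by (simp add: field_simps)
    then have "s * K s \<le> e * (s * K s + l)"
      using denom_pos[OF s(2)] by (simp add: ulap[OF s(2)] field_simps)
    then have "(1 - e) * (s * K s) \<le> e * l" by (simp add: algebra_simps)
    moreover have "l < (1 - e) * (s * K s)" using s(1) e by (simp add: field_simps)
    moreover have "e * l < l" using e l by simp
    ultimately show False by linarith
  qed
  then obtain t1 where t1: "0 < t1" "e < u t1" by blast
  show "\<forall>\<^sub>F t in at_right 0. e < u t"
  proof (rule eventually_at_rightI[OF _ t1(1)])
    fix t assume "t \<in> {0<..<t1}"
    then show "e < u t" using completely_monotone_antimono[OF ucm, of t t1] t1 by simp
  qed
qed

lemma u_deriv: "0 < t \<Longrightarrow> (u has_real_derivative - l * v t) (at t)"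
  using completely_monotone_deriv[OF ucm, of t 0] l by (simp add: v_def)

lemma higher_deriv_v:
  assumes "0 < t"
  shows "(deriv ^^ n) v t = - (deriv ^^ Suc n) u t / l"
    and "((deriv ^^ n) v has_real_derivative - (deriv ^^ Suc (Suc n)) u t / l) (at t)"
proof -
  have d: "((\<lambda>t. - (deriv ^^ Suc n) u t / l) has_real_derivative - (deriv ^^ Suc (Suc n)) u t / l) (at t)"
    if "0 < t" for n t
    by (intro DERIV_cdivide DERIV_minus completely_monotone_deriv ucm that)
  have e: "\<forall>t>0. (deriv ^^ n) v t = - (deriv ^^ Suc n) u t / l" for n
  proof (induction n)
    case (Suc n)
    show ?case
    proof (intro allI impI)
      fix t :: real assume t: "0 < t"
      have "eventually (\<lambda>x. x \<in> {0<..}) (nhds t)"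
        using t by (intro eventually_nhds_in_open) auto
      then have "\<forall>\<^sub>F x in nhds t. (deriv ^^ n) v x = - (deriv ^^ Suc n) u x / l"
        by eventually_elim (use Suc.IH in auto)
      then have "deriv ((deriv ^^ n) v) t = deriv (\<lambda>x. - (deriv ^^ Suc n) u x / l) t"
        by (rule deriv_cong_ev) simp
      also have "\<dots> = - (deriv ^^ Suc (Suc n)) u t / l" by (rule DERIV_imp_deriv[OF d[OF t]])
      finally show "(deriv ^^ Suc n) v t = - (deriv ^^ Suc (Suc n)) u t / l" by simp
    qed
  qed (simp add: v_def)
  show "(deriv ^^ n) v t = - (deriv ^^ Suc n) u t / l" using e assms by blast
  show "((deriv ^^ n) v has_real_derivative - (deriv ^^ Suc (Suc n)) u t / l) (at t)"
    by (rule has_field_derivative_transform_within_open[OF d[OF assms], of "{0<..}"]) (use assms e in auto)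
qed

lemma v_cm: "completely_monotone v"
  unfolding completely_monotone_def
proof (intro allI impI conjI)
  fix n and t :: real assume t: "0 < t"
  show "(deriv ^^ n) v differentiable (at t)"
    using higher_deriv_v(2)[OF t] by (auto simp: real_differentiable_def)
  have "0 \<le> (- 1) ^ Suc n * (deriv ^^ Suc n) u t" using ucm t unfolding completely_monotone_def by blast
  then have "0 \<le> (- 1) ^ Suc n * (deriv ^^ Suc n) u t / l" using l by (rule divide_nonneg_pos)
  then show "0 \<le> (- 1) ^ n * (deriv ^^ n) v t" unfolding higher_deriv_v(1)[OF t] by simp
qed

lemma v_cont: "0 < t \<Longrightarrow> isCont v t"
  using higher_deriv_v(2)[of t 0] by (auto intro: DERIV_isCont)

lemma v_hol: "(\<lambda>z. - deriv g z / of_real l) holomorphic_on right_halfplane"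
  by (intro holomorphic_intros holomorphic_deriv g right_halfplane_facts) (use l in simp)

lemma v_ext: "0 < t \<Longrightarrow> - deriv g (of_real t) / of_real l = of_real (v t)"
  using holomorphic_real_higher_deriv(1)[OF g gu, of t 1] by (simp add: v_def)

text \<open>
  A zero of \<open>v\<close> would make \<open>v\<close> vanish identically, hence \<open>u = 1\<close> and \<open>s u^(s) = 1\<close>,
  contradicting \<open>l > 0\<close>.
\<close>

lemma v_pos:
  assumes "0 < t"
  shows "0 < v t"
proof (rule ccontr)
  assume "\<not> 0 < v t"
  then have "v t = 0" using completely_monotone_nonneg[OF v_cm assms] by simp
  then have v0: "v x = 0" if "0 < x" for x
    using completely_monotone_zero[OF v_hol v_ext v_cm assms] that by simp
  have const: "u x = u 1" if x: "0 < x" for x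
  proof (rule DERIV_isconst3[of 0 "x + 2" x 1])
    fix y assume "y \<in> {0<..<x + 2}"
    then show "(u has_real_derivative 0) (at y)" using u_deriv[of y] v0[of y] by simp
  qed (use x in auto)
  have "(u \<longlongrightarrow> u 1) (at_right 0)"
    by (rule tendsto_eventually, rule eventually_at_rightI[of 0 1]) (rule const, auto)
  then have "u 1 = 1" using tendsto_unique[OF _ _ u_at_0] by auto
  then have const1: "u x = 1" if "0 < x" for x using const[OF that] by simp
  then have "laplace u 1 = (LINT t:{0<..}|lebesgue. exp (- 1 * t))"
    unfolding laplace_def by (intro set_lebesgue_integral_cong) (auto simp: const1)
  then have "K 1 / (1 * K 1 + l) = 1" using laplace_exp_int(2)[of 1] ulap[of 1] by simp
  then show False using denom_pos[of 1] l by (simp add: field_simps)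
qed

lemma u_strict:
  assumes "0 < t"
  shows "0 < u t" "u t < 1"
proof -
  have dec: "u y < u x" if "0 < x" "x < y" for x y
  proof (rule DERIV_neg_imp_decreasing[OF that(2)])
    fix z assume "x \<le> z" "z \<le> y"
    then have "0 < z" using that by simp
    then show "\<exists>d. (u has_real_derivative d) (at z) \<and> d < 0"
      using u_deriv[of z] mult_pos_pos[OF l v_pos[of z]] by (intro exI conjI) auto
  qed
  show "0 < u t" using dec[of t "t + 1"] completely_monotone_nonneg[OF ucm, of "t + 1"] assms by simp
  show "u t < 1" using dec[of "t / 2" t] u1[of "t / 2"] assms by simp
qed

text \<open>
  Integrate the derivative of \<open>- exp (- s t) u t\<close> over the half-line; the integrand is
  nonnegative, so its integrability is part of the conclusion.
\<close>

lemma v_laplace: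
  assumes s: "0 < s"
  shows "laplace_exists v s" "laplace v s = 1 / (s * K s + l)"
proof -
  define F where "F t = - (exp (- s * t) * u t)" for t
  define f where "f t = s * (exp (- s * t) * u t) + l * (exp (- s * t) * v t)" for t
  have F: "(F has_real_derivative f t) (at t)" if "0 < t" for t
    unfolding F_def f_def by (auto intro!: derivative_eq_intros u_deriv that simp: algebra_simps)
  have cu: "isCont u t" if "0 < t" for t using u_deriv[OF that] by (rule DERIV_isCont)
  have f: "isCont f t" if "0 < t" for t
    unfolding f_def by (intro continuous_intros cu v_cont that)
  have f0: "0 \<le> f t" if "0 < t" for t
    unfolding f_def using v_pos[OF that] u_strict[OF that] s l by simp
  have A: "(F \<longlongrightarrow> - (exp (- s * 0) * 1)) (at_right 0)"
    unfolding F_def by (intro tendsto_intros u_at_0)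
  have B: "(F \<longlongrightarrow> 0) at_top"
  proof (rule Lim_null_comparison)
    show "\<forall>\<^sub>F t in at_top. norm (F t) \<le> exp (- s * t)"
      using eventually_gt_at_top[of "0::real"]
    proof eventually_elim
      case (elim t)
      then show ?case using u_strict[of t] by (simp add: F_def abs_mult mult_left_le)
    qed
    show "((\<lambda>t. exp (- s * t)) \<longlongrightarrow> 0) at_top" using s by real_asymp
  qed
  have E: "einterval 0 \<infinity> = {0<..}" by (auto simp: einterval_def zero_ereal_def)
  have int: "set_integrable lebesgue {0<..} f" "(LINT t:{0<..}|lebesgue. f t) = 1"
    using FTC_nonneg_lebesgue[of \<infinity> F f "- (exp (- s * 0) * 1)" 0] F f f0 A B
    unfolding E by (simp_all add: ereal_tendsto_simps1)
  have U: "set_integrable lebesgue {0<..} (\<lambda>t. s * (exp (- s * t) * u t))"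
    using uex[OF s] unfolding laplace_exists_def by (rule set_integrable_mult_right)
  have V: "f t - s * (exp (- s * t) * u t) = l * (exp (- s * t) * v t)" for t by (simp add: f_def)
  have iV: "set_integrable lebesgue {0<..} (\<lambda>t. l * (exp (- s * t) * v t))"
    using set_integral_diff(1)[OF int(1) U] by (simp only: V)
  have "set_integrable lebesgue {0<..} (\<lambda>t. (1 / l) * (l * (exp (- s * t) * v t)))"
    using iV by (rule set_integrable_mult_right)
  then show ex: "laplace_exists v s" using l by (simp add: laplace_exists_def)
  have "l * laplace v s = (LINT t:{0<..}|lebesgue. f t) - (LINT t:{0<..}|lebesgue. s * (exp (- s * t) * u t))"
    using set_integral_diff(2)[OF int(1) U] unfolding V by (simp add: laplace_def)
  also have "\<dots> = 1 - s * laplace u s" by (simp add: int laplace_def)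
  also have "\<dots> = l * (1 / (s * K s + l))" using denom_pos[OF s] by (simp add: ulap[OF s] field_simps)
  finally show "laplace v s = 1 / (s * K s + l)" using l by (metis mult_left_cancel less_irrefl)
qed

lemma v_integral:
  assumes T: "0 < T"
  shows "l * (LINT t:{0<..T}|lebesgue. v t) = 1 - u T"
proof -
  have E: "einterval 0 (ereal T) = {0<..<T}" by (auto simp: einterval_def zero_ereal_def)
  have "(u \<longlongrightarrow> u T) (at_left T)"
    using DERIV_isCont[OF u_deriv[OF T]] by (simp add: isCont_def filterlim_at_split)
  then have B: "(((\<lambda>t. - u t) \<circ> real_of_ereal) \<longlongrightarrow> - u T) (at_left (ereal T))"
    unfolding ereal_tendsto_simps1 by (rule tendsto_minus)
  have "(LINT t:{0<..<T}|lebesgue. l * v t) = - u T - - 1"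
    unfolding E[symmetric]
  proof (rule FTC_nonneg_lebesgue(2)[where F="\<lambda>t. - u t", OF _ _ _ _ _ B])
    fix t :: real assume t: "0 < t"
    show "((\<lambda>t. - u t) has_real_derivative l * v t) (at t)"
      using DERIV_minus[OF u_deriv[OF t]] by simp
    show "isCont (\<lambda>t. l * v t) t" by (intro continuous_intros v_cont t)
    show "0 \<le> l * v t" using l v_pos[OF t] by simp
  qed (use T tendsto_minus[OF u_at_0] in \<open>auto simp: zero_ereal_def\<close>)
  moreover have "(LINT t:{0<..<T}|lebesgue. l * v t) = (LINT t:{0<..T}|lebesgue. l * v t)"
    unfolding set_lebesgue_integral_def
  proof (rule integral_cong_AE)
    have "AE t in lebesgue. t \<notin> {T}" by (rule AE_not_in) auto
    then show "AE t in lebesgue. indicat_real {0<..<T} t *\<^sub>R (l * v t) = indicat_real {0<..T} t *\<^sub>R (l * v t)"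
      by eventually_elim (auto simp: indicator_def)
    have m: "(\<lambda>t. indicat_real S t *\<^sub>R (l * v t)) \<in> borel_measurable lebesgue" 
      if "S \<subseteq> {0<..}" "S \<in> sets borel" for S
    proof (rule measurable_completion)
      have "continuous_on {0<..} (\<lambda>t. l * v t)"
        using v_cont by (intro continuous_intros continuous_at_imp_continuous_on) auto
      then have "continuous_on S (\<lambda>t. l * v t)" using that by (meson continuous_on_subset)
      then show "(\<lambda>t. indicat_real S t *\<^sub>R (l * v t)) \<in> borel_measurable lborel"
        using borel_measurable_continuous_on_indicator[OF that(2), of "\<lambda>t. l * v t"] by simp
    qed
    show "(\<lambda>t. indicat_real {0<..<T} t *\<^sub>R (l * v t)) \<in> borel_measurable lebesgue"
      "(\<lambda>t. indicat_real {0<..T} t *\<^sub>R (l * v t)) \<in> borel_measurable lebesgue"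
      by (rule m; auto)+
  qed
  ultimately show ?thesis by simp
qed

end

section \<open>Passage to the limit\<close>

text \<open>
  The approximating entire functions; \<open>approx_u\<close> and \<open>approx_v\<close> are their real traces and the
  corresponding impulse responses.
\<close>

definition approx :: "(real \<Rightarrow> real) \<Rightarrow> real \<Rightarrow> nat \<Rightarrow> complex \<Rightarrow> complex" where
  "approx f l N = szasz (real (Suc N)) (approx_seq f l N)"

definition approx_u :: "(real \<Rightarrow> real) \<Rightarrow> real \<Rightarrow> nat \<Rightarrow> real \<Rightarrow> real" where
  "approx_u f l N = szasz_real (real (Suc N)) (approx_seq f l N)"

definition approx_v :: "(real \<Rightarrow> real) \<Rightarrow> real \<Rightarrow> nat \<Rightarrow> real \<Rightarrow> real" where
  "approx_v f l N t = real (Suc N) * szasz_real (real (Suc N)) (\<lambda>m. nabla (approx_seq f l N) m / l) t"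

text \<open>
  Montel's theorem for the uniform bound \<open>1\<close>. The subsequence is taken inside a given \<open>r0\<close>, so
  that later two values of \<open>l\<close> can share one.
\<close>

lemma approx_limit:
  assumes f: "completely_monotone f" and l: "0 < l"
  obtains r g where "strict_mono (r :: nat \<Rightarrow> nat)" "g holomorphic_on right_halfplane"
    "\<And>j z. 0 < Re z \<Longrightarrow> (\<lambda>N. (deriv ^^ j) (approx f l (r0 (r N))) z) \<longlonglongrightarrow> (deriv ^^ j) g z"
proof -
  let ?F = "\<lambda>N. approx f l (r0 N)"
  have hol: "approx f l N holomorphic_on S" for N S
    unfolding approx_def by (rule szasz_holomorphic[OF cm_seq_approx[OF f l]])
  have bd: "norm (approx f l N z) \<le> 1" if "0 < Re z" for N z
    unfolding approx_def
    by (rule order_trans[OF norm_szasz_le[OF cm_seq_approx[OF f l] _ that] approx_seq_le_1[OF f l]]) simp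
  obtain g r where g: "g holomorphic_on right_halfplane" and r: "strict_mono (r :: nat \<Rightarrow> nat)"
    and ul: "\<And>K. compact K \<Longrightarrow> K \<subseteq> right_halfplane \<Longrightarrow> uniform_limit K (?F \<circ> r) g sequentially"
    by (rule Montel[OF right_halfplane_facts(1), of "range ?F" ?F])
       (use hol bd in \<open>auto intro!: exI[of _ 1]\<close>)
  show thesis
  proof (rule that[OF r g])
    fix j z assume z: "0 < Re (z :: complex)"
    have sub: "cball z (Re z / 2) \<subseteq> right_halfplane"
    proof
      fix w assume "w \<in> cball z (Re z / 2)"
      then have "\<bar>Re (z - w)\<bar> \<le> Re z / 2"
        using abs_Re_le_cmod[of "z - w"] by (simp add: dist_norm)
      then have "\<bar>Re z - Re w\<bar> \<le> Re z / 2" by simp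
      then have "0 < Re w" using z by linarith
      then show "w \<in> right_halfplane" by simp
    qed
    have "uniform_limit (ball z (Re z / 2)) (?F \<circ> r) g sequentially"
      by (rule uniform_limit_on_subset[OF ul[OF compact_cball sub]]) auto
    from higher_deriv_complex_uniform_limit[OF this, of z j]
    show "(\<lambda>N. (deriv ^^ j) (approx f l (r0 (r N))) z) \<longlonglongrightarrow> (deriv ^^ j) g z"
      using z hol by (auto simp: o_def)
  qed
qed

lemma approx_real:
  assumes f: "completely_monotone f" and l: "0 < l"
  shows "approx f l N (of_real t) = of_real (approx_u f l N t)"
    and "(deriv ^^ j) (approx f l N) (of_real t) =
      of_real ((- real (Suc N)) ^ j * szasz_real (real (Suc N)) ((nabla ^^ j) (approx_seq f l N)) t)"
  unfolding approx_def approx_u_def higher_deriv_szasz[OF cm_seq_approx[OF f l]]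
  using szasz_of_real[OF cm_seq_approx[OF f l]] szasz_of_real[OF cm_seq_nabla_funpow[OF cm_seq_approx[OF f l]]]
  by simp_all

lemma approx_v_eq:
  assumes f: "completely_monotone f" and l: "0 < l"
  shows "- deriv (approx f l N) (of_real t) / of_real l = of_real (approx_v f l N t)"
proof -
  have "szasz_real n (\<lambda>m. (1 / l) * nabla (approx_seq f l N) m) t = (1 / l) * szasz_real n (nabla (approx_seq f l N)) t" for n
    by (rule szasz_real_scale[OF cm_seq_nabla[OF cm_seq_approx[OF f l]]])
  then show ?thesis
    using approx_real(2)[OF f l, where j=1] by (simp add: approx_v_def del: of_nat_Suc)
qed

lemma approx_antitone:
  assumes f: "completely_monotone f" and l: "0 < l1" "l1 \<le> l" and t: "0 < t"
  shows "approx_u f l N t \<le> approx_u f l1 N t" and "approx_v f l N t \<le> approx_v f l1 N t"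
proof -
  have l': "0 < l" using l by simp
  have cm: "cm_seq (\<lambda>m. nabla (approx_seq f k N) m / k)" if "0 < k" for k
    using cm_seq_scale[OF cm_seq_nabla[OF cm_seq_approx[OF f that]], of "1 / k"] that by simp
  show "approx_u f l N t \<le> approx_u f l1 N t"
    unfolding approx_u_def
    by (intro szasz_real_mono cm_seq_approx approx_seq_antitone(1) f l l') (use t in auto)
  show "approx_v f l N t \<le> approx_v f l1 N t"
    unfolding approx_v_def
    by (intro mult_left_mono szasz_real_mono cm approx_seq_antitone(2) f l l') (use t in auto)
qed

text \<open>
  Signs of derivatives and bounds pass to the limit pointwise, the transform by dominated
  convergence.
\<close>

lemma relaxation_construction:
  assumes f: "completely_monotone f" and ex: "\<And>s. 0 < s \<Longrightarrow> laplace_exists f s"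
    and inf: "filterlim (\<lambda>s. s * laplace f s) at_top at_top"
    and l: "0 < l" and r0: "strict_mono (r0 :: nat \<Rightarrow> nat)"
  obtains r u v g where "strict_mono (r :: nat \<Rightarrow> nat)" "relaxation_data u v (laplace f) l g"
    "\<And>t. 0 < t \<Longrightarrow> (\<lambda>N. approx_u f l (r0 (r N)) t) \<longlonglongrightarrow> u t"
    "\<And>t. 0 < t \<Longrightarrow> (\<lambda>N. approx_v f l (r0 (r N)) t) \<longlonglongrightarrow> v t"
proof -
  obtain r g where r: "strict_mono (r :: nat \<Rightarrow> nat)" and g: "g holomorphic_on right_halfplane"
    and lim: "\<And>j z. 0 < Re z \<Longrightarrow> (\<lambda>N. (deriv ^^ j) (approx f l (r0 (r N))) z) \<longlonglongrightarrow> (deriv ^^ j) g z"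
    using approx_limit[OF f l] by metis
  define u where "u t = Re (g (of_real t))" for t
  define v where "v = (\<lambda>t. - deriv u t / l)"
  have gc: "(\<lambda>N. complex_of_real (approx_u f l (r0 (r N)) t)) \<longlonglongrightarrow> g (of_real t)" if "0 < t" for t
    using lim[of "of_real t" 0] that by (simp add: approx_real(1)[OF f l])
  have ulim: "(\<lambda>N. approx_u f l (r0 (r N)) t) \<longlonglongrightarrow> u t" if "0 < t" for t
    using tendsto_Re[OF gc[OF that]] by (simp add: u_def)
  have gu: "g (of_real t) = of_real (u t)" if "0 < t" for t
    by (rule LIMSEQ_unique[OF gc[OF that]]) (intro tendsto_intros ulim that)
  have dlim: "(\<lambda>N. (- real (Suc (r0 (r N)))) ^ j * szasz_real (real (Suc (r0 (r N)))) ((nabla ^^ j) (approx_seq f l (r0 (r N)))) t)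
      \<longlonglongrightarrow> (deriv ^^ j) u t" if "0 < t" for t j
    using tendsto_Re[OF lim[of "of_real t" j]] that
    by (simp only: approx_real(2)[OF f l] holomorphic_real_higher_deriv(1)[OF g gu that] Re_complex_of_real)
  have bnd: "0 \<le> approx_u f l N t \<and> approx_u f l N t \<le> 1" if "0 < t" for N t
    unfolding approx_u_def
    using szasz_real_nonneg[OF cm_seq_approx[OF f l], of "real (Suc N)" t N]
      order_trans[OF szasz_real_le[OF cm_seq_approx[OF f l], of "real (Suc N)" t] approx_seq_le_1[OF f l]] that
    by simp
  have ub: "0 \<le> u t" "u t \<le> 1" if "0 < t" for t
    using LIMSEQ_le_const[OF ulim[OF that], of 0] LIMSEQ_le_const2[OF ulim[OF that], of 1] bnd[OF that] by auto
  have ucm: "completely_monotone u"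
    unfolding completely_monotone_def
  proof (intro allI impI conjI)
    fix n and t :: real assume t: "0 < t"
    show "(deriv ^^ n) u differentiable (at t)"
      using holomorphic_real_higher_deriv(2)[OF g gu t] by (auto simp: real_differentiable_def)
    have lim_n: "(\<lambda>N. (- 1) ^ n * ((- real (Suc (r0 (r N)))) ^ n * szasz_real (real (Suc (r0 (r N)))) ((nabla ^^ n) (approx_seq f l (r0 (r N)))) t))
        \<longlonglongrightarrow> (- 1) ^ n * (deriv ^^ n) u t"
      by (intro tendsto_mult_left dlim t)
    have nonneg: "0 \<le> (- 1) ^ n * ((- real (Suc N)) ^ n * szasz_real (real (Suc N)) ((nabla ^^ n) (approx_seq f l N)) t)" for N
    proof -
      have "(- 1) ^ n * (- real (Suc N)) ^ n = real (Suc N) ^ n"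
        by (simp only: power_mult_distrib[symmetric] mult_minus1 minus_minus)
      then show ?thesis
        using szasz_real_nonneg[OF cm_seq_nabla_funpow[OF cm_seq_approx[OF f l]], of "real (Suc N)" t n N] t
        by (simp only: mult.assoc[symmetric]) simp
    qed
    show "0 \<le> (- 1) ^ n * (deriv ^^ n) u t" by (rule LIMSEQ_le_const[OF lim_n]) (use nonneg in blast)
  qed
  have lap: "laplace_exists u s \<and> laplace u s = laplace f s / (s * laplace f s + l)" if s: "0 < s" for s
  proof -
    let ?w = "\<lambda>h t. indicat_real {0<..} t *\<^sub>R (exp (- s * t) * h t)"
    let ?U = "\<lambda>N. approx_u f l (r0 (r N))"
    have w: "integrable lebesgue (?w (\<lambda>_. 1))"
      using laplace_exp_int(1)[OF s] by (simp add: set_integrable_def)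
    have M: "integrable lebesgue (?w (?U N))" for N
      using laplace_szasz(1)[OF cm_seq_approx[OF f l] _ s, of "real (Suc (r0 (r N)))"]
      unfolding laplace_exists_def set_integrable_def approx_u_def by simp
    have pl: "(\<lambda>N. ?w (?U N) t) \<longlonglongrightarrow> ?w u t" for t
      using ulim[of t] by (cases "0 < t") (auto intro!: tendsto_intros)
    have bd: "norm (?w (?U N) t) \<le> ?w (\<lambda>_. 1) t" for N t
      using bnd[of t] by (cases "0 < t") (auto simp: abs_mult intro!: mult_left_le)
    have um: "?w u \<in> borel_measurable lebesgue"
      by (rule borel_measurable_LIMSEQ_metric[OF borel_measurable_integrable[OF M] pl])
    have "integrable lebesgue (?w u)"
      by (rule integrable_dominated_convergence[OF um borel_measurable_integrable[OF M] w])
        (rule AE_I2, rule pl, rule AE_I2, rule bd)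
    then have "laplace_exists u s" by (simp add: laplace_exists_def set_integrable_def)
    moreover have "(\<lambda>N. laplace (?U N) s) \<longlonglongrightarrow> laplace u s"
      unfolding laplace_def set_lebesgue_integral_def
      by (rule integral_dominated_convergence[OF um borel_measurable_integrable[OF M] w])
        (rule AE_I2, rule pl, rule AE_I2, rule bd)
    moreover have "(\<lambda>N. laplace (?U N) s) \<longlonglongrightarrow> laplace f s / (s * laplace f s + l)"
      using LIMSEQ_subseq_LIMSEQ[OF laplace_approx[OF f ex l s] strict_mono_o[OF r0 r]]
      by (simp add: o_def approx_u_def)
    ultimately show ?thesis using LIMSEQ_unique by blast
  qed
  have K: "0 \<le> laplace f s" if "0 < s" for s
    by (rule laplace_nonneg[OF completely_monotone_nonneg[OF f]])
  have data: "relaxation_data u v (laplace f) l g"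
    by unfold_locales (use l K inf g gu ucm ub lap v_def in auto)
  have "(\<lambda>N. approx_v f l (r0 (r N)) t) \<longlonglongrightarrow> v t" if t: "0 < t" for t
  proof -
    have "(\<lambda>N. - deriv (approx f l (r0 (r N))) (of_real t) / of_real l) \<longlonglongrightarrow> - deriv g (of_real t) / of_real l"
      using lim[of "of_real t" 1] t l by (intro tendsto_intros) auto
    then have "(\<lambda>N. complex_of_real (approx_v f l (r0 (r N)) t)) \<longlonglongrightarrow> of_real (v t)"
      unfolding approx_v_eq[OF f l] relaxation_data.v_ext[OF data t] .
    from tendsto_Re[OF this] show ?thesis by simp
  qed
  with r data ulim show thesis by (intro that)
qed

section \<open>The relaxation equation\<close>

lemma laplace_cong:
  assumes "\<And>t. 0 < t \<Longrightarrow> f t = g t"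
  shows "laplace_exists f s = laplace_exists g s" "laplace f s = laplace g s"
proof -
  show "laplace_exists f s = laplace_exists g s"
    unfolding laplace_exists_def by (rule set_integrable_cong) (use assms in auto)
  show "laplace f s = laplace g s"
    unfolding laplace_def by (rule set_lebesgue_integral_cong) (use assms in auto)
qed

text \<open>
  Since \<open>K s \<ge> b\<close> and \<open>s K s \<ge> a\<close>, the two limits force both constants to be \<open>0\<close>.
\<close>

lemma stieltjes_without_linear_part:
  assumes st: "stieltjes_function K" and inf: "(K \<longlongrightarrow> 0) at_top"
    and zero: "((\<lambda>s. s * K s) \<longlongrightarrow> 0) (at_right 0)"
  obtains \<psi> where "completely_monotone \<psi>" "\<And>s. 0 < s \<Longrightarrow> laplace_exists \<psi> s"
    "\<And>s. 0 < s \<Longrightarrow> K s = laplace \<psi> s"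
proof -
  obtain a b \<psi> where ab: "0 \<le> a" "0 \<le> b" and \<psi>: "completely_monotone \<psi>"
    and ex: "\<And>s. 0 < s \<Longrightarrow> laplace_exists \<psi> s"
    and K: "\<And>s. 0 < s \<Longrightarrow> K s = a / s + b + laplace \<psi> s"
    using st unfolding stieltjes_function_def by blast
  have pos: "0 \<le> laplace \<psi> s" for s
    by (rule laplace_nonneg[OF completely_monotone_nonneg[OF \<psi>]])
  have "a \<le> 0"
  proof (rule tendsto_lowerbound[OF zero])
    show "\<forall>\<^sub>F s in at_right 0. a \<le> s * K s"
      by (rule eventually_at_rightI[of 0 1]) (use ab pos in \<open>auto simp: K distrib_left\<close>)
  qed simp
  moreover have "b \<le> 0"
  proof (rule tendsto_lowerbound[OF inf])
    show "\<forall>\<^sub>F s in at_top. b \<le> K s"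
      using eventually_gt_at_top[of 0] by eventually_elim (use ab pos in \<open>auto simp: K add_nonneg_nonneg\<close>)
  qed simp
  ultimately have "K s = laplace \<psi> s" if "0 < s" for s using K[OF that] ab by simp
  with \<psi> ex show thesis by (rule that)
qed

text \<open>
  The kernel enters only through its transform, which agrees with that of the completely
  monotone \<open>\<psi>\<close>.
\<close>

locale stieltjes_kernel =
  fixes k \<psi> :: "real \<Rightarrow> real"
  assumes \<psi>: "completely_monotone \<psi>" and ex: "\<And>s. 0 < s \<Longrightarrow> laplace_exists \<psi> s"
    and k\<psi>: "\<And>s. 0 < s \<Longrightarrow> laplace k s = laplace \<psi> s"
    and inf: "filterlim (\<lambda>s. s * laplace \<psi> s) at_top at_top"
begin

lemma solutions_exist:
  assumes l: "0 < l"
  shows "\<exists>u. fundamental_solution k l u" "\<exists>v. impulse_response k l v"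
proof -
  obtain r U V g where data: "relaxation_data U V (laplace \<psi>) l g"
    using relaxation_construction[OF \<psi> ex inf l strict_mono_id] by metis
  interpret relaxation_data U V "laplace \<psi>" l g by (rule data)
  have contV: "continuous_on {0<..} V"
    using v_cont by (intro continuous_at_imp_continuous_on) auto
  show "\<exists>v. impulse_response k l v"
    using contV v_laplace by (auto simp: impulse_response_def symbol_of_def k\<psi>)
  \<comment> \<open>\<open>U\<close> is only controlled for \<open>t > 0\<close>; continuity at \<open>0\<close> dictates the value \<open>1\<close> there.\<close>
  define u where "u t = (if t \<le> 0 then 1 else U t)" for t
  have uU: "u t = U t" if "0 < t" for t using that by (simp add: u_def)
  have "continuous_on {0..} u"
    unfolding continuous_on_eq_continuous_within
  proof
    fix t :: real assume "t \<in> {0..}"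
    show "continuous (at t within {0..}) u"
    proof (cases "t = 0")
      case True
      have "(u \<longlongrightarrow> 1) (at_right 0)"
        by (rule Lim_transform_eventually[OF u_at_0], rule eventually_at_rightI[of 0 1]) (auto simp: u_def)
      then show ?thesis by (simp add: True continuous_within at_within_Ici_at_right u_def)
    next
      case False
      then have t: "0 < t" using \<open>t \<in> {0..}\<close> by simp
      have "(u has_real_derivative - l * V t) (at t)"
        by (rule has_field_derivative_transform_within_open[OF u_deriv[OF t], of "{0<..}"]) (use t uU in auto)
      then show ?thesis using DERIV_isCont continuous_at_imp_continuous_at_within by blast
    qed
  qed
  moreover have "laplace_exists u s" "laplace u s = laplace \<psi> s / (s * laplace \<psi> s + l)" if "0 < s" for s
    using laplace_cong[of u U s, OF uU] uex[OF that] ulap[OF that] by simp_all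
  ultimately show "\<exists>u. fundamental_solution k l u"
    by (auto simp: fundamental_solution_def symbol_of_def k\<psi>)
qed

text \<open>
  The constructed pair has the transforms of the given one, so uniqueness identifies them for
  \<open>t > 0\<close>.
\<close>

lemma solutions_are_limits:
  assumes l: "0 < l" and u: "fundamental_solution k l u" and v: "impulse_response k l v"
    and r0: "strict_mono (r0 :: nat \<Rightarrow> nat)"
  obtains r U V g where "strict_mono (r :: nat \<Rightarrow> nat)" "relaxation_data U V (laplace \<psi>) l g"
    "\<And>t. 0 < t \<Longrightarrow> u t = U t" "\<And>t. 0 < t \<Longrightarrow> v t = V t"
    "\<And>t. 0 < t \<Longrightarrow> (\<lambda>N. approx_u \<psi> l (r0 (r N)) t) \<longlonglongrightarrow> u t"
    "\<And>t. 0 < t \<Longrightarrow> (\<lambda>N. approx_v \<psi> l (r0 (r N)) t) \<longlonglongrightarrow> v t"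
proof -
  obtain r U V g where r: "strict_mono (r :: nat \<Rightarrow> nat)" and data: "relaxation_data U V (laplace \<psi>) l g"
    and lims: "\<And>t. 0 < t \<Longrightarrow> (\<lambda>N. approx_u \<psi> l (r0 (r N)) t) \<longlonglongrightarrow> U t"
      "\<And>t. 0 < t \<Longrightarrow> (\<lambda>N. approx_v \<psi> l (r0 (r N)) t) \<longlonglongrightarrow> V t"
    using relaxation_construction[OF \<psi> ex inf l r0] by metis
  interpret relaxation_data U V "laplace \<psi>" l g by (rule data)
  have uU: "u t = U t" if t: "0 < t" for t
  proof (rule laplace_unique[OF _ _ _ _ _ t])
    show "continuous_on {0<..} u"
      using u unfolding fundamental_solution_def by (auto intro: continuous_on_subset)
    show "continuous_on {0<..} U"
      by (intro continuous_at_imp_continuous_on) (auto intro: DERIV_isCont[OF u_deriv])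
    fix s :: real assume s: "0 < s"
    show "laplace_exists u s" "laplace_exists U s"
      using u s uex unfolding fundamental_solution_def by auto
    show "laplace u s = laplace U s"
      using u s ulap[OF s] unfolding fundamental_solution_def by (simp add: symbol_of_def k\<psi>)
  qed
  have vV: "v t = V t" if t: "0 < t" for t
  proof (rule laplace_unique[OF _ _ _ _ _ t])
    show "continuous_on {0<..} v" using v unfolding impulse_response_def by auto
    show "continuous_on {0<..} V"
      using v_cont by (intro continuous_at_imp_continuous_on) auto
    fix s :: real assume s: "0 < s"
    show "laplace_exists v s" "laplace_exists V s"
      using v s v_laplace unfolding impulse_response_def by auto
    show "laplace v s = laplace V s"
      using v s v_laplace(2)[OF s] unfolding impulse_response_def by (simp add: symbol_of_def k\<psi>)
  qed
  show thesis by (rule that[OF r data uU vV]) (use lims uU vV in auto)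
qed

lemma solution_properties:
  assumes l: "0 < l" and u: "fundamental_solution k l u" and v: "impulse_response k l v"
  shows "has_holomorphic_extension u" "has_holomorphic_extension v"
    "completely_monotone u" "completely_monotone v" "u 0 = 1"
    "0 < t \<Longrightarrow> 0 < u t" "0 < t \<Longrightarrow> u t < 1" "0 < t \<Longrightarrow> 0 < v t"
    "0 < t \<Longrightarrow> (u has_real_derivative - l * v t) (at t)"
    "0 < t \<Longrightarrow> l * (LINT \<tau>:{0<..t}|lebesgue. v \<tau>) = 1 - u t"
proof -
  obtain r U V g where data: "relaxation_data U V (laplace \<psi>) l g"
    and uU: "\<And>t. 0 < t \<Longrightarrow> u t = U t" and vV: "\<And>t. 0 < t \<Longrightarrow> v t = V t"
    using solutions_are_limits[OF l u v strict_mono_id] by metis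
  interpret relaxation_data U V "laplace \<psi>" l g by (rule data)
  show "has_holomorphic_extension u"
    unfolding has_holomorphic_extension_def using g gu uU by auto
  show "has_holomorphic_extension v"
    unfolding has_holomorphic_extension_def
    by (rule exI[of _ "\<lambda>z. - deriv g z / of_real l"]) (use v_hol v_ext vV in auto)
  show "completely_monotone u" by (rule completely_monotone_cong[OF _ ucm]) (simp add: uU)
  show "completely_monotone v" by (rule completely_monotone_cong[OF _ v_cm]) (simp add: vV)
  have "continuous (at 0 within {0..}) u"
    using u by (simp add: fundamental_solution_def continuous_on_eq_continuous_within)
  then have "(u \<longlongrightarrow> u 0) (at_right 0)" by (simp add: continuous_within at_within_Ici_at_right)
  moreover have "(u \<longlongrightarrow> 1) (at_right 0)"
    by (rule Lim_transform_eventually[OF u_at_0], rule eventually_at_rightI[of 0 1]) (auto simp: uU)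
  ultimately show "u 0 = 1" using tendsto_unique by force
  show "0 < u t" "u t < 1" "0 < v t" "(u has_real_derivative - l * v t) (at t)"
    "l * (LINT \<tau>:{0<..t}|lebesgue. v \<tau>) = 1 - u t" if t: "0 < t"
  proof -
    show "0 < u t" "u t < 1" "0 < v t" using u_strict[OF t] v_pos[OF t] uU[OF t] vV[OF t] by auto
    show "(u has_real_derivative - l * v t) (at t)"
      unfolding vV[OF t]
      by (rule has_field_derivative_transform_within_open[OF u_deriv[OF t], of "{0<..}"]) (use t uU in auto)
    have "(LINT \<tau>:{0<..t}|lebesgue. v \<tau>) = (LINT \<tau>:{0<..t}|lebesgue. V \<tau>)"
      by (rule set_lebesgue_integral_cong) (use vV in auto)
    then show "l * (LINT \<tau>:{0<..t}|lebesgue. v \<tau>) = 1 - u t" using v_integral[OF t] uU[OF t] by simp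
  qed
qed

text \<open>
  The inequalities hold for the approximants; both solutions are limits along one subsequence,
  obtained by extracting for \<open>l1\<close> inside the subsequence for \<open>l\<close>.
\<close>

lemma solutions_antitone:
  assumes l: "0 < l1" "l1 \<le> l" and t: "0 < t"
    and uv: "fundamental_solution k l u" "impulse_response k l v"
    and uv1: "fundamental_solution k l1 u1" "impulse_response k l1 v1"
  shows "u t \<le> u1 t" "v t \<le> v1 t"
proof -
  have l': "0 < l" using l by simp
  obtain r where r: "strict_mono (r :: nat \<Rightarrow> nat)"
    and lim: "\<And>t. 0 < t \<Longrightarrow> (\<lambda>N. approx_u \<psi> l (r N) t) \<longlonglongrightarrow> u t"
      "\<And>t. 0 < t \<Longrightarrow> (\<lambda>N. approx_v \<psi> l (r N) t) \<longlonglongrightarrow> v t"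
    by (rule solutions_are_limits[OF l' uv strict_mono_id, unfolded id_apply]) (rule that)
  obtain r1 where r1: "strict_mono (r1 :: nat \<Rightarrow> nat)"
    and lim1: "\<And>t. 0 < t \<Longrightarrow> (\<lambda>N. approx_u \<psi> l1 (r (r1 N)) t) \<longlonglongrightarrow> u1 t"
      "\<And>t. 0 < t \<Longrightarrow> (\<lambda>N. approx_v \<psi> l1 (r (r1 N)) t) \<longlonglongrightarrow> v1 t"
    by (rule solutions_are_limits[OF l(1) uv1 r]) (rule that)
  have lim2: "(\<lambda>N. approx_u \<psi> l (r (r1 N)) t) \<longlonglongrightarrow> u t" "(\<lambda>N. approx_v \<psi> l (r (r1 N)) t) \<longlonglongrightarrow> v t"
    using LIMSEQ_subseq_LIMSEQ[OF lim(1)[OF t] r1] LIMSEQ_subseq_LIMSEQ[OF lim(2)[OF t] r1] by (simp_all add: o_def)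
  show "u t \<le> u1 t"
    by (rule LIMSEQ_le[OF lim2(1) lim1(1)[OF t]]) (use approx_antitone(1)[OF \<psi> l t] in blast)
  show "v t \<le> v1 t"
    by (rule LIMSEQ_le[OF lim2(2) lim1(2)[OF t]]) (use approx_antitone(2)[OF \<psi> l t] in blast)
qed

end

theorem theorem2p2:
  fixes k :: "real \<Rightarrow> real"
  assumes "locally_integrable k"
    and "AE t in lebesgue. 0 < t \<longrightarrow> 0 \<le> k t"
    and "\<forall>s>0. laplace_exists k s"
    and "stieltjes_function (laplace k)"
    and "(laplace k \<longlongrightarrow> 0) at_top"
    and "filterlim (\<lambda>s. s * laplace k s) at_top at_top"
    and "filterlim (laplace k) at_top (at_right 0)"
    and "((\<lambda>s. s * laplace k s) \<longlongrightarrow> 0) (at_right 0)"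
  shows "(\<forall>lam>0. (\<exists>u. fundamental_solution k lam u) \<and> (\<exists>v. impulse_response k lam v)) \<and>
    (\<forall>u v :: real \<Rightarrow> real \<Rightarrow> real.
      (\<forall>lam>0. fundamental_solution k lam (u lam) \<and> impulse_response k lam (v lam)) \<longrightarrow>
      (\<forall>lam>0.
         has_holomorphic_extension (u lam) \<and> has_holomorphic_extension (v lam) \<and>
         completely_monotone (u lam) \<and> completely_monotone (v lam) \<and>
         u lam 0 = 1 \<and> (\<forall>t>0. 0 < u lam t \<and> u lam t < 1 \<and> 0 < v lam t) \<and>
         (\<forall>t>0. (u lam has_real_derivative - lam * v lam t) (at t))) \<and>
      (\<forall>lam lam1 t. 0 < lam1 \<and> lam1 \<le> lam \<and> 0 < t \<longrightarrow>
         u lam t \<le> u lam1 t \<and> v lam t \<le> v lam1 t) \<and>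
      (\<forall>lam lam1 T. 0 < lam1 \<and> lam1 \<le> lam \<and> 0 < T \<longrightarrow>
         0 < 1 - u lam1 T \<and>
         1 - u lam1 T \<le> lam * (LINT t:{0<..T}|lebesgue. v lam t) \<and>
         lam * (LINT t:{0<..T}|lebesgue. v lam t) < 1))"
proof -
  obtain \<psi> where \<psi>: "completely_monotone \<psi>" "\<And>s. 0 < s \<Longrightarrow> laplace_exists \<psi> s"
    "\<And>s. 0 < s \<Longrightarrow> laplace k s = laplace \<psi> s"
    using stieltjes_without_linear_part[OF assms(4,5,8)] by metis
  have "\<forall>\<^sub>F s in at_top. s * laplace k s = s * laplace \<psi> s"
    using eventually_gt_at_top[of 0] by eventually_elim (simp add: \<psi>(3))
  then have inf: "filterlim (\<lambda>s. s * laplace \<psi> s) at_top at_top"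
    using assms(6) by (rule filterlim_cong[OF refl refl, THEN iffD1])
  interpret stieltjes_kernel k \<psi>
    by unfold_locales (use \<psi> inf in auto)
  let ?P = "\<lambda>u v :: real \<Rightarrow> real \<Rightarrow> real. \<forall>lam>0.
         has_holomorphic_extension (u lam) \<and> has_holomorphic_extension (v lam) \<and>
         completely_monotone (u lam) \<and> completely_monotone (v lam) \<and>
         u lam 0 = 1 \<and> (\<forall>t>0. 0 < u lam t \<and> u lam t < 1 \<and> 0 < v lam t) \<and>
         (\<forall>t>0. (u lam has_real_derivative - lam * v lam t) (at t))"
  let ?Q = "\<lambda>u v :: real \<Rightarrow> real \<Rightarrow> real. \<forall>lam lam1 t. 0 < lam1 \<and> lam1 \<le> lam \<and> 0 < t \<longrightarrow>
         u lam t \<le> u lam1 t \<and> v lam t \<le> v lam1 t"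
  let ?R = "\<lambda>u v :: real \<Rightarrow> real \<Rightarrow> real. \<forall>lam lam1 T. 0 < lam1 \<and> lam1 \<le> lam \<and> 0 < T \<longrightarrow>
         0 < 1 - u lam1 T \<and>
         1 - u lam1 T \<le> lam * (LINT t:{0<..T}|lebesgue. v lam t) \<and>
         lam * (LINT t:{0<..T}|lebesgue. v lam t) < 1"
  show ?thesis
  proof (rule conjI)
    show "\<forall>lam>0. (\<exists>u. fundamental_solution k lam u) \<and> (\<exists>v. impulse_response k lam v)"
      by (intro allI impI conjI solutions_exist)
  next
    show "\<forall>u v :: real \<Rightarrow> real \<Rightarrow> real.
      (\<forall>lam>0. fundamental_solution k lam (u lam) \<and> impulse_response k lam (v lam)) \<longrightarrow> ?P u v \<and> ?Q u v \<and> ?R u v"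
    proof (intro allI impI)
      fix u v :: "real \<Rightarrow> real \<Rightarrow> real"
      assume uv: "\<forall>lam>0. fundamental_solution k lam (u lam) \<and> impulse_response k lam (v lam)"
      have u: "fundamental_solution k lam (u lam)" and v: "impulse_response k lam (v lam)" if "0 < lam" for lam
        using uv that by auto
      note p = solution_properties[OF _ u v]
      show "?P u v \<and> ?Q u v \<and> ?R u v"
      proof (intro conjI)
        show "?P u v" by (intro allI impI conjI p) assumption+
        have le: "u lam t \<le> u lam1 t" "v lam t \<le> v lam1 t" if "0 < lam1 \<and> lam1 \<le> lam \<and> 0 < t" for lam lam1 t
        proof -
          have "0 < lam1" "lam1 \<le> lam" "0 < t" "0 < lam" using that by auto
          then show "u lam t \<le> u lam1 t" "v lam t \<le> v lam1 t"
            using solutions_antitone[of lam1 lam t "u lam" "v lam" "u lam1" "v lam1"] u v by auto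
        qed
        then show "?Q u v" by blast
        show "?R u v"
        proof (intro allI impI)
          fix lam lam1 T :: real assume l: "0 < lam1 \<and> lam1 \<le> lam \<and> 0 < T"
          then have "0 < lam1" "0 < lam" "0 < T" by auto
          then show "0 < 1 - u lam1 T \<and>
            1 - u lam1 T \<le> lam * (LINT t:{0<..T}|lebesgue. v lam t) \<and>
            lam * (LINT t:{0<..T}|lebesgue. v lam t) < 1"
            using le(1)[OF l] p(6,10)[of lam T] p(7)[of lam1 T] by auto
        qed
      qed
    qed
  qed
qed

end
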